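(* There exists a constant $C>0$ such that $$\sup_{t>0}\frac{M(t)}{(\log(e+1/t))^{1/2}} \le C,$$ where, for $t>0$, $$M(t) := \sup_{f \in H^1(\mathbb{R}^2) \setminus \{0\}}\frac{\|e^{t\Delta}f\|_{L^{\infty}(\mathbb{R}^2)}}{\|f\|_{H^1(\mathbb{R}^2)}}$$ and $\{e^{t\Delta}\}_{t\ge 0}$ is the heat semigroup on $\mathbb{R}^2$.
   Context: Functions are complex-valued. The Fourier transform and its inverse on $\mathbb{R}^2$ are normalized by $$(\mathcal{F}f)(\xi) := \frac{1}{2\pi}\int_{\mathbb{R}^2}e^{-ix\cdot\xi}f(x)\,dx, \qquad (\mathcal{F}^{-1}f)(x) := \frac{1}{2\pi}\int_{\mathbb{R}^2}e^{ix\cdot\xi}f(\xi)\,d\xi$$ for Schwartz functions $f$, and extended to unitary operators on $L^2(\mathbb{R}^2)$. The Sobolev space $H^1(\mathbb{R}^2)$ is the set of $f\in L^2(\mathbb{R}^2)$ with $$\|f\|_{H^1(\mathbb{R}^2)} := \left(\int_{\mathbb{R}^2}(1+|\xi|^2)|(\mathcal{F}f)(\xi)|^2\,d\xi\right)^{1/2}<\infty.$$ The heat semigroup is defined by $e^{t\Delta} := \mathcal{F}^{-1}e^{-t|\cdot|^2}\mathcal{F}$ for $t\ge 0$, i.e. $e^{t\Delta}f=\mathcal{F}^{-1}[e^{-t|\xi|^2}(\mathcal{F}f)(\xi)]$. *)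

theory Defs
  imports "HOL-Analysis.Analysis" "HOL-Probability.Essential_Supremum"
begin

definition partial_deriv :: "2 \<Rightarrow> (real^2 \<Rightarrow> complex) \<Rightarrow> real^2 \<Rightarrow> complex" where
  "partial_deriv i f x = frechet_derivative f (at x) (axis i 1)"

text \<open>
  A Schwartz function: all iterated partial derivatives (the list \<open>is\<close> gives the directions)
  exist, are differentiable, and decay faster than any power of \<open>norm x\<close>.
\<close>

definition schwartz :: "(real^2 \<Rightarrow> complex) \<Rightarrow> bool" where
  "schwartz f \<longleftrightarrow> (\<forall>is.
     (\<forall>x. foldr partial_deriv is f differentiable (at x)) \<and>
     (\<forall>k::nat. bounded (range (\<lambda>x. norm x ^ k *\<^sub>R foldr partial_deriv is f x))))"

definition fourier_schwartz :: "(real^2 \<Rightarrow> complex) \<Rightarrow> real^2 \<Rightarrow> complex" where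
  "fourier_schwartz f \<xi> =
     1 / (2 * of_real pi) * (LINT x|lebesgue. exp (- \<i> * of_real (x \<bullet> \<xi>)) * f x)"

definition inv_fourier_schwartz :: "(real^2 \<Rightarrow> complex) \<Rightarrow> real^2 \<Rightarrow> complex" where
  "inv_fourier_schwartz f x =
     1 / (2 * of_real pi) * (LINT \<xi>|lebesgue. exp (\<i> * of_real (x \<bullet> \<xi>)) * f \<xi>)"

text \<open>
  Elements of \<open>L\<^sup>2\<close> are represented by functions; two functions represent the same element iff
  they agree almost everywhere.
\<close>

definition square_integrable :: "(real^2 \<Rightarrow> complex) \<Rightarrow> bool" where
  "square_integrable f \<longleftrightarrow>
     f \<in> borel_measurable lebesgue \<and> integrable lebesgue (\<lambda>x. (norm (f x))\<^sup>2)"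

definition L2_tendsto :: "(nat \<Rightarrow> real^2 \<Rightarrow> complex) \<Rightarrow> (real^2 \<Rightarrow> complex) \<Rightarrow> bool" where
  "L2_tendsto u f \<longleftrightarrow>
     (\<lambda>n. \<integral>\<^sup>+x. ennreal ((norm (u n x - f x))\<^sup>2) \<partial>lebesgue) \<longlonglongrightarrow> 0"

text \<open>
  The continuous extension to \<open>L\<^sup>2\<close> of an operator \<open>T\<close> given on Schwartz functions, through
  approximation in \<open>L\<^sup>2\<close>. For \<open>L\<^sup>2\<close>-isometric \<open>T\<close> the value exists and is unique up to
  equality almost everywhere, and Hilbert choice picks one representative.
\<close>

definition L2_extension ::
  "((real^2 \<Rightarrow> complex) \<Rightarrow> real^2 \<Rightarrow> complex) \<Rightarrow> (real^2 \<Rightarrow> complex) \<Rightarrow> real^2 \<Rightarrow> complex" where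
  "L2_extension T f = (SOME g. square_integrable g \<and>
     (\<exists>u. (\<forall>n. schwartz (u n)) \<and> L2_tendsto u f \<and> L2_tendsto (\<lambda>n. T (u n)) g))"

definition fourier :: "(real^2 \<Rightarrow> complex) \<Rightarrow> real^2 \<Rightarrow> complex" where
  "fourier = L2_extension fourier_schwartz"

definition inv_fourier :: "(real^2 \<Rightarrow> complex) \<Rightarrow> real^2 \<Rightarrow> complex" where
  "inv_fourier = L2_extension inv_fourier_schwartz"

definition H1 :: "(real^2 \<Rightarrow> complex) set" where
  "H1 = {f. square_integrable f \<and>
     integrable lebesgue (\<lambda>\<xi>. (1 + (norm \<xi>)\<^sup>2) * (norm (fourier f \<xi>))\<^sup>2)}"

definition H1_norm :: "(real^2 \<Rightarrow> complex) \<Rightarrow> real" where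
  "H1_norm f = sqrt (LINT \<xi>|lebesgue. (1 + (norm \<xi>)\<^sup>2) * (norm (fourier f \<xi>))\<^sup>2)"

definition heat_semigroup :: "real \<Rightarrow> (real^2 \<Rightarrow> complex) \<Rightarrow> real^2 \<Rightarrow> complex" where
  "heat_semigroup t f =
     inv_fourier (\<lambda>\<xi>. of_real (exp (- t * (norm \<xi>)\<^sup>2)) * fourier f \<xi>)"

definition Linf_norm :: "(real^2 \<Rightarrow> complex) \<Rightarrow> ereal" where
  "Linf_norm f = esssup lebesgue (\<lambda>x. ereal (norm (f x)))"

text \<open>
  The supremum is taken in the extended reals, so that no finiteness is presupposed; \<open>f \<noteq> 0\<close> in
  \<open>H\<^sup>1\<close> means that \<open>f\<close> does not vanish almost everywhere.
\<close>

definition heat_H1_Linf_norm :: "real \<Rightarrow> ereal" where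
  "heat_H1_Linf_norm t =
     (SUP f \<in> {f \<in> H1. \<not> (AE x in lebesgue. f x = 0)}.
        Linf_norm (heat_semigroup t f) / ereal (H1_norm f))"

end

theory Submission
  imports Defs "HOL-Probability.Characteristic_Functions" "HOL-Probability.Sinc_Integral"
begin

text \<open>
  The integral defining the Fourier transform satisfies \<open>\<parallel>\<F> u\<parallel>\<^sub>2 \<le> \<parallel>u\<parallel>\<^sub>2\<close> for every integrable \<open>u\<close>
  (insert a Gaussian factor \<open>exp (- e \<bar>\<xi>\<bar>\<^sup>2)\<close>, use Fubini's theorem, and let \<open>e\<close> tend to 0); neither
  Plancherel's identity nor Fourier inversion is needed. Together with the density of Schwartz
  functions and the completeness of \<open>L\<^sup>2\<close>, this inequality shows that the \<open>L\<^sup>2\<close> extensions exist, and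
  that they agree almost everywhere with the defining integral on integrable functions. Hence
  \<open>2 \<pi> \<parallel>exp (t \<Delta>) f\<parallel>\<^sub>\<infinity>\<close> is at most the integral of \<open>exp (- t \<bar>\<xi>\<bar>\<^sup>2) \<bar>\<F> f \<xi>\<bar>\<close>. By the Cauchy--Schwarz
  inequality this is at most \<open>\<parallel>f\<parallel>\<close> in \<open>H\<^sup>1\<close> times the square root of the integral of
  \<open>exp (- 2 t \<bar>\<xi>\<bar>\<^sup>2) / (1 + \<bar>\<xi>\<bar>\<^sup>2)\<close>. Writing \<open>1 / (1 + \<bar>\<xi>\<bar>\<^sup>2)\<close> as the integral of
  \<open>exp (- \<tau> (1 + \<bar>\<xi>\<bar>\<^sup>2))\<close> over \<open>\<tau> > 0\<close> turns the latter into the integral of \<open>\<pi> exp (- \<tau>) / (2 t + \<tau>)\<close>,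
  which grows logarithmically in \<open>1 / t\<close>.
\<close>

section \<open>Gaussian integrals\<close>

text \<open>The known characteristic function of the standard normal distribution, rescaled:
  substituting \<open>c * x\<close> for the variable turns the normal density into
  \<open>exp (- e * x^2)\<close> up to a constant.\<close>

lemma gauss_fourier_1d:
  fixes e t :: real
  assumes "e > 0"
  shows "has_bochner_integral lborel (\<lambda>x::real. exp (\<i> * of_real (t * x)) * of_real (exp (- e * x\<^sup>2)))
    (of_real (sqrt (pi / e) * exp (- t\<^sup>2 / (4 * e))) :: complex)"
proof -
  \<comment> \<open>With this choice \<open>(c * x)^2 / 2 = e * x^2\<close>, and the frequency
    \<open>t\<close> becomes \<open>t / c\<close>.\<close>
  define c where "c = sqrt (2 * e)"
  have c: "c > 0" "c\<^sup>2 = 2 * e" using assms by (auto simp: c_def)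
  have *: "has_bochner_integral lborel (\<lambda>x::real. std_normal_density x *\<^sub>R iexp (u * x)) (complex_of_real (exp (- (u\<^sup>2) / 2)))" for u
  proof -
    have "integrable std_normal_distribution (\<lambda>x. iexp (u * x))"
      by (rule finite_measure.integrable_const_bound[where B=1, OF prob_space.axioms(1)[OF prob_space_normal_density]]) simp_all
    then have i: "integrable lborel (\<lambda>x. std_normal_density x *\<^sub>R iexp (u * x))"
      by (subst (asm) integrable_density) auto
    have "(LINT x|lborel. std_normal_density x *\<^sub>R iexp (u * x)) = char std_normal_distribution u"
      unfolding char_def by (subst integral_density) auto
    then show ?thesis using i char_std_normal_distribution by (auto simp: has_bochner_integral_iff)
  qed
  \<comment> \<open>Linear change of variables; the Jacobian contributes the factor
    \<open>1 / \<bar>c\<bar>\<close>.\<close>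
  have "has_bochner_integral lborel (\<lambda>x::real. std_normal_density (0 + c * x) *\<^sub>R iexp (t / c * (0 + c * x))) (complex_of_real (exp (- ((t/c)\<^sup>2) / 2)) /\<^sub>R \<bar>c\<bar>)"
    using c(1) by (intro lborel_has_bochner_integral_real_affine_iff[THEN iffD1] *) simp
  then have "has_bochner_integral lborel (\<lambda>x::real. sqrt (2 * pi) *\<^sub>R (std_normal_density (0 + c * x) *\<^sub>R iexp (t / c * (0 + c * x)))) (sqrt (2 * pi) *\<^sub>R (complex_of_real (exp (- ((t/c)\<^sup>2) / 2)) /\<^sub>R \<bar>c\<bar>))"
    by (intro has_bochner_integral_scaleR_right)
  moreover have "sqrt (2 * pi) *\<^sub>R (std_normal_density (0 + c * x) *\<^sub>R iexp (t / c * (0 + c * x)))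
     = exp (\<i> * of_real (t * x)) * of_real (exp (- e * x\<^sup>2))" for x
    using c by (simp add: std_normal_density_def scaleR_conv_of_real power_mult_distrib mult_ac)
  moreover have "sqrt (2 * pi) *\<^sub>R (complex_of_real (exp (- ((t/c)\<^sup>2) / 2)) /\<^sub>R \<bar>c\<bar>)
     = of_real (sqrt (pi / e) * exp (- t\<^sup>2 / (4 * e)))"
  proof -
    have "sqrt (2*pi) / c = sqrt (pi / e)"
      unfolding c_def by (simp add: real_sqrt_divide[symmetric])
    then have "sqrt (2*pi) * (exp (- ((t/c)\<^sup>2) / 2) / c) = sqrt (pi / e) * exp (- t\<^sup>2 / (4 * e))"
      using c by (simp add: power_divide field_simps)
    moreover have "sqrt (2 * pi) *\<^sub>R (complex_of_real y /\<^sub>R \<bar>c\<bar>) = of_real (sqrt (2 * pi) * (y / c))" for y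
      using c(1) by (simp add: scaleR_conv_of_real divide_inverse)
    ultimately show ?thesis by (simp only:)
  qed
  ultimately show ?thesis by simp
qed

text \<open>Lebesgue measure is the image of the product of one-dimensional Lebesgue measures under
  summing coordinates along the basis, so Fubini's theorem factors the integral.\<close>

lemma has_bochner_integral_lborel_prod:
  fixes f :: "'a::euclidean_space \<Rightarrow> real \<Rightarrow> complex"
  assumes "\<And>b. b \<in> Basis \<Longrightarrow> has_bochner_integral lborel (f b) (I b)"
  shows "has_bochner_integral lborel (\<lambda>x::'a. \<Prod>b\<in>Basis. f b (x \<bullet> b)) (\<Prod>b\<in>Basis. I b)"
proof -
  interpret product_sigma_finite "\<lambda>_::'a. lborel :: real measure" ..
  have i: "integrable lborel (f b)" and [measurable]: "f b \<in> borel_measurable borel" if "b \<in> Basis" for b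
    using assms[OF that] by (auto simp: has_bochner_integral_iff)
  have I: "integral\<^sup>L lborel (f b) = I b" if "b \<in> Basis" for b
    using assms[OF that] by (auto simp: has_bochner_integral_iff)
  have [simp]: "(\<Sum>c\<in>Basis. g c *\<^sub>R c) \<bullet> b = g b" if "b \<in> Basis" for b :: 'a and g
    using that by (simp add: inner_sum_left inner_Basis if_distrib cong: if_cong)
  have [measurable]: "(\<lambda>x::'a. \<Prod>b\<in>Basis. f b (x \<bullet> b)) \<in> borel_measurable borel"
    by measurable
  show ?thesis unfolding lborel_eq[where 'a='a]
    by (auto simp: has_bochner_integral_iff integrable_distr_eq integral_distr i I product_integral_prod product_integrable_prod cong: prod.cong)
qed

text \<open>Both the inner product and the squared norm are sums over \<open>Basis\<close>, so the
  integrand is a product of one-dimensional integrands.\<close>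

lemma gauss_fourier:
  fixes z :: "'a::euclidean_space"
  assumes "e > 0"
  shows "has_bochner_integral lborel (\<lambda>x. exp (\<i> * of_real (z \<bullet> x)) * of_real (exp (- e * (norm x)\<^sup>2)))
    (of_real (sqrt (pi / e) ^ DIM('a) * exp (- (norm z)\<^sup>2 / (4 * e))) :: complex)"
proof -
  have n: "(norm x)\<^sup>2 = (\<Sum>b\<in>Basis. (x \<bullet> b)\<^sup>2)" for x :: 'a
    unfolding power2_norm_eq_inner by (subst euclidean_inner) (simp add: power2_eq_square)
  have "has_bochner_integral lborel
     (\<lambda>x::'a. \<Prod>b\<in>Basis. exp (\<i> * of_real ((z \<bullet> b) * (x \<bullet> b))) * of_real (exp (- e * (x \<bullet> b)\<^sup>2)))
     (\<Prod>b\<in>(Basis::'a set). of_real (sqrt (pi / e) * exp (- (z \<bullet> b)\<^sup>2 / (4 * e))) :: complex)"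
    by (intro has_bochner_integral_lborel_prod gauss_fourier_1d assms)
  moreover have "(\<Prod>b\<in>Basis. exp (\<i> * of_real ((z \<bullet> b) * (x \<bullet> b))) * of_real (exp (- e * (x \<bullet> b)\<^sup>2))) =
    exp (\<i> * of_real (z \<bullet> x)) * complex_of_real (exp (- e * (norm x)\<^sup>2))" for x
    unfolding n euclidean_inner[of z x]
    by (simp add: prod.distrib exp_sum sum_distrib_left sum_negf[symmetric] flip: of_real_prod)
  moreover have "(\<Prod>b\<in>(Basis::'a set). of_real (sqrt (pi / e) * exp (- (z \<bullet> b)\<^sup>2 / (4 * e))))
    = complex_of_real (sqrt (pi / e) ^ DIM('a) * exp (- (norm z)\<^sup>2 / (4 * e)))"
    unfolding n
    by (simp add: prod.distrib exp_sum sum_divide_distrib sum_negf[symmetric] flip: of_real_prod)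
  ultimately show ?thesis by simp
qed

text \<open>The case of frequency 0, followed by translation invariance to move the centre to
  \<open>c\<close>.\<close>

lemma gauss_integral:
  fixes c :: "'a::euclidean_space"
  assumes "e > 0"
  shows "has_bochner_integral lborel (\<lambda>x. exp (- e * (norm (x - c))\<^sup>2)) (sqrt (pi / e) ^ DIM('a))"
proof -
  have "has_bochner_integral lborel (\<lambda>x::'a. Re (exp (\<i> * of_real (0 \<bullet> x)) * of_real (exp (- e * (norm x)\<^sup>2))))
    (Re (of_real (sqrt (pi / e) ^ DIM('a) * exp (- (norm (0::'a))\<^sup>2 / (4 * e)))))"
    by (intro has_bochner_integral_Re gauss_fourier assms)
  then have "has_bochner_integral lborel (\<lambda>x::'a. exp (- e * (norm x)\<^sup>2)) (sqrt (pi / e) ^ DIM('a))"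
    by (simp add: Re_exp)
  then have "has_bochner_integral (distr lborel borel ((+) (-c))) (\<lambda>x::'a. exp (- e * (norm x)\<^sup>2)) (sqrt (pi / e) ^ DIM('a))"
    by (simp only: lborel_distr_plus)
  then show ?thesis
    by (auto simp: has_bochner_integral_iff integrable_distr_eq integral_distr)
qed

section \<open>The Fourier integral is a contraction in \<open>L\<^sup>2\<close>\<close>

lemma has_bochner_integral_lebesgueI:
  "has_bochner_integral lborel f (I :: 'b::{banach, second_countable_topology}) \<Longrightarrow> has_bochner_integral lebesgue f I"
  by (auto simp: has_bochner_integral_iff integrable_completion integral_completion)

text \<open>Fubini's theorem is applied below to products of completed measures, so sigma-finiteness
  is carried over from \<open>lborel\<close>.\<close>

lemma sigma_finite_lebesgue: "sigma_finite_measure (lebesgue :: 'a::euclidean_space measure)"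
proof -
  obtain A :: "'a set set" where A: "countable A" "A \<subseteq> sets lborel" "\<Union>A = space lborel" "\<forall>a\<in>A. emeasure lborel a \<noteq> \<infinity>"
    using sigma_finite_lborel unfolding sigma_finite_measure_def by blast
  then show ?thesis unfolding sigma_finite_measure_def
    by (intro exI[of _ A]) auto
qed

interpretation lebesgue: sigma_finite_measure lebesgue
  by (rule sigma_finite_lebesgue)

interpretation lebesgue_pair: pair_sigma_finite lebesgue lebesgue ..

text \<open>The squared L2 norm. Values in \<open>ennreal\<close> make it available for every
  function, so that finiteness can be a conclusion.\<close>

definition sq_int :: "(real^2 \<Rightarrow> complex) \<Rightarrow> ennreal" where
  "sq_int f = (\<integral>\<^sup>+x. ennreal ((norm (f x))\<^sup>2) \<partial>lebesgue)"

text \<open>One definition for both transforms: \<open>s = -1\<close> is the forward and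
  \<open>s = 1\<close> the inverse one. The estimates use the sign through
  \<open>s^2 = 1\<close>.\<close>

definition fourier_L1 :: "real \<Rightarrow> (real^2 \<Rightarrow> complex) \<Rightarrow> real^2 \<Rightarrow> complex" where
  "fourier_L1 s u \<xi> = 1 / (2 * of_real pi) * (LINT x|lebesgue. exp (\<i> * of_real (s * (x \<bullet> \<xi>))) * u x)"

lemma id_borel_lebesgue: "(\<lambda>x. x) \<in> measurable lebesgue borel"
  by (rule measurable_completion) simp

lemma fst_lebesgue: "fst \<in> measurable (lebesgue \<Otimes>\<^sub>M M) borel"
  using measurable_compose[OF measurable_fst id_borel_lebesgue] .

lemma snd_lebesgue: "snd \<in> measurable (M \<Otimes>\<^sub>M lebesgue) borel"
  using measurable_compose[OF measurable_snd id_borel_lebesgue] .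

lemma measurable_fourier_L1 [measurable]:
  assumes [measurable]: "u \<in> borel_measurable lebesgue"
  shows "fourier_L1 s u \<in> borel_measurable lebesgue"
proof -
  note fst_lebesgue[measurable] snd_lebesgue[measurable]
  have [measurable]: "(\<lambda>p. u (snd p)) \<in> borel_measurable (lebesgue \<Otimes>\<^sub>M lebesgue)"
    using assms measurable_compose measurable_snd by blast
  have "(\<lambda>\<xi>. LINT x|lebesgue. exp (\<i> * of_real (s * (x \<bullet> \<xi>))) * u x) \<in> borel_measurable (lebesgue :: (real^2) measure)"
    by measurable
  then show ?thesis unfolding fourier_L1_def[abs_def] by simp
qed

lemma integrable_tensor:
  fixes u v :: "_ \<Rightarrow> complex"
  assumes "sigma_finite_measure M" "sigma_finite_measure N"
  assumes u: "integrable M u" and v: "integrable N v"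
  shows "integrable (M \<Otimes>\<^sub>M N) (\<lambda>p. u (fst p) * v (snd p))"
proof -
  interpret M: sigma_finite_measure M by fact
  interpret N: sigma_finite_measure N by fact
  interpret pair_sigma_finite M N ..
  have [measurable]: "u \<in> borel_measurable M" "v \<in> borel_measurable N" using u v by auto
  show ?thesis
    by (rule Fubini_integrable) (use u v in \<open>auto simp: norm_mult\<close>)
qed

text \<open>Writing the squared modulus as a double integral and integrating the Gaussian in
  \<open>\<xi>\<close> first gives a quadratic form in \<open>u\<close> with the nonnegative kernel
  \<open>k (x - y)\<close>. The integral of \<open>k\<close> is \<open>4 * pi^2\<close> for every
  \<open>e\<close>, so a Schur test bounds the form independently of \<open>e\<close>.\<close>

lemma fourier_L1_gauss_bound:
  assumes u: "integrable lebesgue u" and s: "s\<^sup>2 = 1" and e: "e > 0"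
  shows "(\<integral>\<^sup>+\<xi>. ennreal ((norm (fourier_L1 s u \<xi>))\<^sup>2 * exp (- e * (norm \<xi>)\<^sup>2)) \<partial>lebesgue) \<le> sq_int u"
proof -
  let ?L = "lebesgue :: (real^2) measure"
  let ?P = "?L \<Otimes>\<^sub>M ?L"
  have P: "sigma_finite_measure ?P" by (rule sigma_finite_pair_measure) (rule sigma_finite_lebesgue)+
  interpret P: sigma_finite_measure ?P by (rule P)
  interpret PL: pair_sigma_finite ?P ?L ..
  have [measurable]: "u \<in> borel_measurable ?L" using u by auto
  define E where "E = (\<lambda>x \<xi> :: real^2. exp (\<i> * of_real (s * (x \<bullet> \<xi>))))"
  define w where "w = (\<lambda>p. u (fst p) * cnj (u (snd p)))"
  define g where "g = (\<lambda>\<xi>::real^2. complex_of_real (exp (- e * (norm \<xi>)\<^sup>2)))"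
  \<comment> \<open>The Fourier integral of the Gaussian \<open>g\<close> in dimension two, where
    \<open>sqrt (pi / e)^2 = pi / e\<close>.\<close>
  define k where "k = (\<lambda>z::real^2. (pi / e) * exp (- (norm z)\<^sup>2 / (4 * e)))"
  have "(\<lambda>x. cnj (u x)) \<in> borel_measurable ?L"
    using u by (intro borel_measurable_integrable) simp
  from measurable_compose[OF measurable_snd this]
  have [measurable]: "w \<in> borel_measurable ?P"
    unfolding w_def by measurable
  have [measurable]: "g \<in> borel_measurable ?L"
    unfolding g_def by (rule measurable_completion) measurable
  have [measurable]: "k \<in> borel_measurable borel"
    unfolding k_def by measurable
  have [measurable]: "(\<lambda>p. fst p - snd p) \<in> borel_measurable ?P"
    by (intro borel_measurable_diff fst_lebesgue snd_lebesgue)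
  have [measurable]: "(\<lambda>q. E (fst (fst q) - snd (fst q)) (snd q)) \<in> borel_measurable (?P \<Otimes>\<^sub>M ?L)"
    using snd_lebesgue[of ?P, measurable] unfolding E_def by measurable
  have [measurable]: "(\<lambda>q. E (fst q - snd q) \<xi>) \<in> borel_measurable ?P" for \<xi>
    unfolding E_def by measurable
  have [measurable]: "(\<lambda>x. E x \<xi>) \<in> borel_measurable ?L" for \<xi>
    unfolding E_def by (rule measurable_completion) measurable
  have nE: "norm (E x \<xi>) = 1" for x \<xi> by (simp only: E_def norm_exp_i_times)
  have w: "integrable ?P w"
    unfolding w_def by (intro integrable_tensor sigma_finite_lebesgue u) (use u in simp)
  have g: "integrable ?L g"
    using has_bochner_integral_lebesgueI[OF gauss_fourier[OF e, of "0::real^2"]]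
    by (auto simp: has_bochner_integral_iff g_def)
  have gE: "(LINT \<xi>|?L. E z \<xi> * g \<xi>) = of_real (k z)" for z
  proof -
    \<comment> \<open>The Gaussian depends only on the norm of the frequency, so the sign
      \<open>s\<close> disappears.\<close>
    have "(norm (s *\<^sub>R z))\<^sup>2 = (norm z)\<^sup>2" using s by (simp add: power_mult_distrib)
    moreover have "has_bochner_integral ?L (\<lambda>\<xi>. E z \<xi> * g \<xi>)
      (of_real (sqrt (pi / e) ^ DIM(real^2) * exp (- (norm (s *\<^sub>R z))\<^sup>2 / (4 * e))))"
      using has_bochner_integral_lebesgueI[OF gauss_fourier[OF e, of "s *\<^sub>R z"]]
      by (simp add: E_def g_def)
    ultimately show ?thesis using e
      by (simp add: has_bochner_integral_iff k_def power2_eq_square[symmetric] real_sqrt_pow2)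
  qed
  \<comment> \<open>A squared modulus is an integral times its conjugate, hence an integral over
    pairs of points, and the two exponentials combine into one at \<open>x - y\<close>.\<close>
  have sq: "of_real ((norm (fourier_L1 s u \<xi>))\<^sup>2) =
      1 / (4 * of_real pi ^ 2) * (\<integral>p. E (fst p - snd p) \<xi> * w p \<partial>?P)" for \<xi>
  proof -
    have E: "E (x - y) \<xi> = E x \<xi> * cnj (E y \<xi>)" for x y
      by (simp add: E_def exp_cnj inner_diff_left right_diff_distrib exp_diff exp_minus divide_inverse)
    have Eu: "integrable ?L (\<lambda>x. E x \<xi> * u x)"
      by (rule Bochner_Integration.integrable_bound[OF u]) (auto simp: norm_mult nE)
    have "(\<integral>p. E (fst p - snd p) \<xi> * w p \<partial>?P) = (\<integral>p. (E (fst p) \<xi> * u (fst p)) * cnj (E (snd p) \<xi> * u (snd p)) \<partial>?P)"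
      by (simp add: w_def E mult_ac)
    also have "\<dots> = (\<integral>x. \<integral>y. (E x \<xi> * u x) * cnj (E y \<xi> * u y) \<partial>?L \<partial>?L)"
      by (subst lebesgue_pair.integral_fst'[symmetric])
        (use Eu in \<open>auto intro!: integrable_tensor sigma_finite_lebesgue simp del: complex_cnj_mult\<close>)
    also have "\<dots> = (\<integral>x. E x \<xi> * u x \<partial>?L) * cnj (\<integral>x. E x \<xi> * u x \<partial>?L)"
      using Eu by (simp del: complex_cnj_mult)
    finally have "(\<integral>p. E (fst p - snd p) \<xi> * w p \<partial>?P) = (\<integral>x. E x \<xi> * u x \<partial>?L) * cnj (\<integral>x. E x \<xi> * u x \<partial>?L)" .
    moreover have "fourier_L1 s u \<xi> = 1 / (2 * of_real pi) * (\<integral>x. E x \<xi> * u x \<partial>?L)"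
      by (simp only: fourier_L1_def E_def)
    ultimately show ?thesis
      unfolding complex_norm_square by (simp add: power2_eq_square)
  qed
  \<comment> \<open>The exponential has modulus 1, so \<open>w\<close> tensor \<open>g\<close> is an
    integrable majorant; this licenses the exchange of integrals below.\<close>
  have int1: "integrable (?P \<Otimes>\<^sub>M ?L) (\<lambda>q. E (fst (fst q) - snd (fst q)) (snd q) * (w (fst q) * g (snd q)))"
    by (rule Bochner_Integration.integrable_bound[OF integrable_tensor[OF P sigma_finite_lebesgue w g]])
       (auto simp: norm_mult nE)
  have a: "complex_of_real ((norm (fourier_L1 s u \<xi>))\<^sup>2 * exp (- e * (norm \<xi>)\<^sup>2)) =
    1 / (4 * of_real pi ^ 2) * (\<integral>p. E (fst p - snd p) \<xi> * (w p * g \<xi>) \<partial>?P)" for \<xi>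
  proof -
    have "complex_of_real ((norm (fourier_L1 s u \<xi>))\<^sup>2 * exp (- e * (norm \<xi>)\<^sup>2)) =
      1 / (4 * of_real pi ^ 2) * (\<integral>p. E (fst p - snd p) \<xi> * w p \<partial>?P) * g \<xi>"
      unfolding of_real_mult sq by (simp add: g_def)
    also have "\<dots> = 1 / (4 * of_real pi ^ 2) * (\<integral>p. E (fst p - snd p) \<xi> * w p * g \<xi> \<partial>?P)"
      by simp
    finally show ?thesis by (simp add: mult.assoc)
  qed
  have i2: "complex_integrable ?L (\<lambda>\<xi>. complex_of_real ((norm (fourier_L1 s u \<xi>))\<^sup>2 * exp (- e * (norm \<xi>)\<^sup>2)))"
    unfolding a using PL.integrable_snd[of "\<lambda>p \<xi>. E (fst p - snd p) \<xi> * (w p * g \<xi>)"] int1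
    by (intro integrable_mult_right) (simp add: split_beta')
  have i3: "integrable ?L (\<lambda>\<xi>. (norm (fourier_L1 s u \<xi>))\<^sup>2 * exp (- e * (norm \<xi>)\<^sup>2))"
    using integrable_Re[OF i2] by simp
  have "complex_of_real (\<integral>\<xi>. (norm (fourier_L1 s u \<xi>))\<^sup>2 * exp (- e * (norm \<xi>)\<^sup>2) \<partial>?L) =
     1 / (4 * of_real pi ^ 2) * (\<integral>\<xi>. \<integral>p. E (fst p - snd p) \<xi> * (w p * g \<xi>) \<partial>?P \<partial>?L)"
    unfolding integral_complex_of_real[symmetric] a by simp
  also have "(\<integral>\<xi>. \<integral>p. E (fst p - snd p) \<xi> * (w p * g \<xi>) \<partial>?P \<partial>?L) = (\<integral>p. \<integral>\<xi>. E (fst p - snd p) \<xi> * (w p * g \<xi>) \<partial>?L \<partial>?P)"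
    by (rule PL.Fubini_integral) (use int1 in \<open>simp add: split_beta'\<close>)
  also have "\<dots> = (\<integral>p. w p * of_real (k (fst p - snd p)) \<partial>?P)"
  proof -
    have "(\<integral>\<xi>. E z \<xi> * (c * g \<xi>) \<partial>?L) = c * of_real (k z)" for c z
      unfolding gE[symmetric] by (subst integral_mult_right_zero[symmetric]) (simp add: mult_ac)
    then show ?thesis by simp
  qed
  finally have eq: "complex_of_real (\<integral>\<xi>. (norm (fourier_L1 s u \<xi>))\<^sup>2 * exp (- e * (norm \<xi>)\<^sup>2) \<partial>?L) =
     1 / (4 * of_real pi ^ 2) * (\<integral>p. w p * of_real (k (fst p - snd p)) \<partial>?P)" .
  have k: "0 \<le> k z" "\<bar>k z\<bar> \<le> \<bar>pi / e\<bar>" for z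
  proof -
    show "0 \<le> k z" using e by (simp add: k_def)
    have "k z \<le> pi / e * 1"
      unfolding k_def using e by (intro mult_left_mono) auto
    with \<open>0 \<le> k z\<close> show "\<bar>k z\<bar> \<le> \<bar>pi / e\<bar>" using e by simp
  qed
  have wk: "integrable ?P (\<lambda>p. w p * of_real (k (fst p - snd p)))"
    by (rule Bochner_Integration.integrable_bound[OF integrable_mult_left[OF w, of "of_real (pi / e)"]])
       (auto simp: norm_mult simp del: of_real_divide abs_divide intro!: mult_left_mono k)
  from eq have "norm (complex_of_real (\<integral>\<xi>. (norm (fourier_L1 s u \<xi>))\<^sup>2 * exp (- e * (norm \<xi>)\<^sup>2) \<partial>?L)) =
    1 / (4 * pi\<^sup>2) * norm (\<integral>p. w p * of_real (k (fst p - snd p)) \<partial>?P)"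
    by (simp only: norm_mult) (simp add: norm_divide norm_mult norm_power)
  then have "(\<integral>\<xi>. (norm (fourier_L1 s u \<xi>))\<^sup>2 * exp (- e * (norm \<xi>)\<^sup>2) \<partial>?L) =
    1 / (4 * pi\<^sup>2) * norm (\<integral>p. w p * of_real (k (fst p - snd p)) \<partial>?P)"
    by (simp add: integral_nonneg_AE)
  then have "(\<integral>\<^sup>+\<xi>. ennreal ((norm (fourier_L1 s u \<xi>))\<^sup>2 * exp (- e * (norm \<xi>)\<^sup>2)) \<partial>?L)
    = ennreal (1 / (4 * pi\<^sup>2)) * ennreal (norm (\<integral>p. w p * of_real (k (fst p - snd p)) \<partial>?P))"
    by (subst nn_integral_eq_integral[OF i3]) (simp_all add: ennreal_mult[symmetric])
  also have "\<dots> \<le> ennreal (1 / (4 * pi\<^sup>2)) * (\<integral>\<^sup>+p. ennreal (norm (w p * of_real (k (fst p - snd p)))) \<partial>?P)"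
    by (intro mult_left_mono integral_norm_bound_ennreal wk) simp
  \<comment> \<open>The Schur test: \<open>2 * a * b \<le> a^2 + b^2\<close> splits the integrand so
    that each half has one variable occurring in \<open>k\<close> alone.\<close>
  also have "\<dots> \<le> ennreal (1 / (4 * pi\<^sup>2)) * (\<integral>\<^sup>+p. ennreal ((norm (u (fst p)))\<^sup>2 / 2 * k (fst p - snd p)) + ennreal ((norm (u (snd p)))\<^sup>2 / 2 * k (fst p - snd p)) \<partial>?P)"
  proof (intro mult_left_mono nn_integral_mono)
    fix p
    have "norm (w p) \<le> (norm (u (fst p)))\<^sup>2 / 2 + (norm (u (snd p)))\<^sup>2 / 2"
      using sum_squares_bound[of "norm (u (fst p))" "norm (u (snd p))"] by (simp add: w_def norm_mult)
    moreover have k0: "k (fst p - snd p) \<ge> 0" using e by (simp add: k_def)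
    ultimately have "norm (w p) * k (fst p - snd p) \<le> ((norm (u (fst p)))\<^sup>2 / 2 + (norm (u (snd p)))\<^sup>2 / 2) * k (fst p - snd p)"
      by (intro mult_right_mono)
    then show "ennreal (norm (w p * of_real (k (fst p - snd p)))) \<le> ennreal ((norm (u (fst p)))\<^sup>2 / 2 * k (fst p - snd p)) + ennreal ((norm (u (snd p)))\<^sup>2 / 2 * k (fst p - snd p))"
      using k0 by (simp add: norm_mult ennreal_plus[symmetric] distrib_right del: ennreal_plus)
  qed simp
  also have "(\<integral>\<^sup>+p. ennreal ((norm (u (fst p)))\<^sup>2 / 2 * k (fst p - snd p)) + ennreal ((norm (u (snd p)))\<^sup>2 / 2 * k (fst p - snd p)) \<partial>?P)
    = (\<integral>\<^sup>+p. ennreal ((norm (u (fst p)))\<^sup>2 / 2 * k (fst p - snd p)) \<partial>?P) + (\<integral>\<^sup>+p. ennreal ((norm (u (snd p)))\<^sup>2 / 2 * k (fst p - snd p)) \<partial>?P)"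
    by (rule nn_integral_add) auto
  also have "(\<integral>\<^sup>+p. ennreal ((norm (u (fst p)))\<^sup>2 / 2 * k (fst p - snd p)) \<partial>?P) = (\<integral>\<^sup>+x. \<integral>\<^sup>+y. ennreal ((norm (u x))\<^sup>2 / 2 * k (x - y)) \<partial>?L \<partial>?L)"
    by (subst lebesgue.nn_integral_fst[symmetric]) auto
  also have "(\<integral>\<^sup>+p. ennreal ((norm (u (snd p)))\<^sup>2 / 2 * k (fst p - snd p)) \<partial>?P) = (\<integral>\<^sup>+y. \<integral>\<^sup>+x. ennreal ((norm (u y))\<^sup>2 / 2 * k (x - y)) \<partial>?L \<partial>?L)"
    using lebesgue_pair.nn_integral_snd[of "\<lambda>(x, y). ennreal ((norm (u y))\<^sup>2 / 2 * k (x - y))", symmetric]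
    by (simp add: split_beta')
  \<comment> \<open>Renaming the variables and using that \<open>k\<close> is even identifies the
    two halves.\<close>
  also have "(\<integral>\<^sup>+y. \<integral>\<^sup>+x. ennreal ((norm (u y))\<^sup>2 / 2 * k (x - y)) \<partial>?L \<partial>?L) = (\<integral>\<^sup>+x. \<integral>\<^sup>+y. ennreal ((norm (u x))\<^sup>2 / 2 * k (x - y)) \<partial>?L \<partial>?L)"
    by (simp add: k_def norm_minus_commute)
  also have "(\<integral>\<^sup>+x. \<integral>\<^sup>+y. ennreal ((norm (u x))\<^sup>2 / 2 * k (x - y)) \<partial>?L \<partial>?L) = ennreal (2 * pi\<^sup>2) * sq_int u"
  proof -
    \<comment> \<open>A Gaussian with parameter \<open>1 / (4 * e)\<close> has integral
      \<open>4 * pi * e\<close> in the plane; the prefactor \<open>pi / e\<close> cancels the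
      \<open>e\<close>.\<close>
    have "has_bochner_integral ?L (\<lambda>y. k (x - y)) (4 * pi\<^sup>2)" for x
      using has_bochner_integral_mult_right[OF has_bochner_integral_lebesgueI[OF gauss_integral[of "1 / (4 * e)" x]], of "pi / e"] e
      by (simp add: k_def norm_minus_commute power2_eq_square[symmetric] real_sqrt_pow2) (simp add: power2_eq_square mult_ac)
    then have "(\<integral>\<^sup>+y. ennreal (k (x - y)) \<partial>?L) = ennreal (4 * pi\<^sup>2)" for x
      by (subst nn_integral_eq_integral) (auto simp: has_bochner_integral_iff k_def e less_imp_le)
    moreover have "(\<lambda>y. ennreal (k (x - y))) \<in> borel_measurable ?L" for x
      by (rule measurable_completion) measurable
    ultimately have "(\<integral>\<^sup>+y. ennreal (a * k (x - y)) \<partial>?L) = ennreal a * ennreal (4 * pi\<^sup>2)" if "a \<ge> 0" for a x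
      using that by (simp add: ennreal_mult' nn_integral_cmult)
    from this[of "(norm (u x))\<^sup>2 / 2" x for x] have "(\<integral>\<^sup>+y. ennreal ((norm (u x))\<^sup>2 / 2 * k (x - y)) \<partial>?L) = ennreal (2 * pi\<^sup>2) * ennreal ((norm (u x))\<^sup>2)" for x
      by (simp add: ennreal_mult[symmetric] del: times_divide_eq_left)
    then show ?thesis by (simp add: nn_integral_cmult sq_int_def)
  qed
  also have "ennreal (1 / (4 * pi\<^sup>2)) * (ennreal (2 * pi\<^sup>2) * sq_int u + ennreal (2 * pi\<^sup>2) * sq_int u) = sq_int u"
    by (simp add: distrib_right[symmetric] ennreal_plus[symmetric] mult.assoc[symmetric] ennreal_mult[symmetric] del: ennreal_plus)
  finally show ?thesis .
qed

text \<open>The Gaussian-weighted bound is uniform in \<open>e\<close>; taking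
  \<open>e = 1 / (n + 1)\<close> and applying Fatou's lemma removes the weight.\<close>

lemma sq_int_fourier_L1_le:
  assumes u: "integrable lebesgue u" and s: "s\<^sup>2 = 1"
  shows "sq_int (fourier_L1 s u) \<le> sq_int u"
proof -
  have [measurable]: "u \<in> borel_measurable lebesgue" using u by auto
  let ?f = "\<lambda>n \<xi>. ennreal ((norm (fourier_L1 s u \<xi>))\<^sup>2 * exp (- (1 / real (Suc n)) * (norm \<xi>)\<^sup>2))"
  have lim: "(\<lambda>n. ?f n \<xi>) \<longlonglongrightarrow> ennreal ((norm (fourier_L1 s u \<xi>))\<^sup>2)" for \<xi>
  proof -
    have "(\<lambda>n. (norm (fourier_L1 s u \<xi>))\<^sup>2 * exp (- (1 / real (Suc n)) * (norm \<xi>)\<^sup>2)) \<longlonglongrightarrow> (norm (fourier_L1 s u \<xi>))\<^sup>2 * exp (- 0 * (norm \<xi>)\<^sup>2)"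
      by (intro tendsto_intros LIMSEQ_Suc lim_1_over_n)
    then show ?thesis by (intro tendsto_ennrealI) simp
  qed
  have "sq_int (fourier_L1 s u) = (\<integral>\<^sup>+\<xi>. liminf (\<lambda>n. ?f n \<xi>) \<partial>lebesgue)"
    unfolding sq_int_def by (intro nn_integral_cong) (metis lim lim_imp_Liminf sequentially_bot)
  also have "\<dots> \<le> liminf (\<lambda>n. \<integral>\<^sup>+\<xi>. ?f n \<xi> \<partial>lebesgue)"
    using id_borel_lebesgue[measurable] by (intro nn_integral_liminf) measurable
  also have "\<dots> \<le> liminf (\<lambda>n. sq_int u)"
    by (intro Liminf_mono always_eventually allI fourier_L1_gauss_bound u s) simp
  finally show ?thesis by (simp add: Liminf_const)
qed

section \<open>Extension to \<open>L\<^sup>2\<close>\<close>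

lemma sq_int_diff_commute: "sq_int (\<lambda>x. f x - g x) = sq_int (\<lambda>x. g x - f x)"
  by (simp add: sq_int_def norm_minus_commute)

text \<open>A substitute for the triangle inequality that works with squares directly; the factors 2
  are harmless for convergence arguments.\<close>

lemma sq_int_add_le:
  assumes [measurable]: "f \<in> borel_measurable lebesgue" "g \<in> borel_measurable lebesgue"
  shows "sq_int (\<lambda>x. f x + g x) \<le> 2 * sq_int f + 2 * sq_int g"
proof -
  have "(norm (a + b))\<^sup>2 \<le> 2 * (norm a)\<^sup>2 + 2 * (norm b)\<^sup>2" for a b :: complex
  proof -
    have "(norm (a + b))\<^sup>2 \<le> (norm a + norm b)\<^sup>2"
      by (intro power_mono norm_triangle_ineq) simp
    also have "\<dots> \<le> 2 * (norm a)\<^sup>2 + 2 * (norm b)\<^sup>2"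
      using sum_squares_bound[of "norm a" "norm b"] by (simp add: power2_sum)
    finally show ?thesis .
  qed
  from ennreal_leI[OF this] have "ennreal ((norm (a + b))\<^sup>2) \<le> 2 * ennreal ((norm a)\<^sup>2) + 2 * ennreal ((norm b)\<^sup>2)" for a b :: complex
    by (simp add: ennreal_mult')
  then have "sq_int (\<lambda>x. f x + g x) \<le> (\<integral>\<^sup>+x. 2 * ennreal ((norm (f x))\<^sup>2) + 2 * ennreal ((norm (g x))\<^sup>2) \<partial>lebesgue)"
    unfolding sq_int_def by (intro nn_integral_mono)
  also have "\<dots> = 2 * sq_int f + 2 * sq_int g"
    unfolding sq_int_def by (subst nn_integral_add) (auto simp: nn_integral_cmult)
  finally show ?thesis .
qed

lemma sq_int_triangle:
  assumes [measurable]: "f \<in> borel_measurable lebesgue" "g \<in> borel_measurable lebesgue" "h \<in> borel_measurable lebesgue"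
  shows "sq_int (\<lambda>x. f x - h x) \<le> 2 * sq_int (\<lambda>x. f x - g x) + 2 * sq_int (\<lambda>x. g x - h x)"
  using sq_int_add_le[of "\<lambda>x. f x - g x" "\<lambda>x. g x - h x"] by simp

lemma sq_int_cmult:
  assumes [measurable]: "f \<in> borel_measurable lebesgue"
  shows "sq_int (\<lambda>x. c * f x) = ennreal ((norm c)\<^sup>2) * sq_int f"
  by (simp add: sq_int_def norm_mult power_mult_distrib ennreal_mult nn_integral_cmult)

lemma sq_int_cong_AE: "(AE x in lebesgue. f x = g x) \<Longrightarrow> sq_int f = sq_int g"
  unfolding sq_int_def by (intro nn_integral_cong_AE) auto

lemma sq_int_eq_0:
  assumes [measurable]: "f \<in> borel_measurable lebesgue"
  shows "sq_int f = 0 \<longleftrightarrow> (AE x in lebesgue. f x = 0)"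
  unfolding sq_int_def by (subst nn_integral_0_iff_AE) auto

lemma square_integrable_iff: "square_integrable f \<longleftrightarrow> f \<in> borel_measurable lebesgue \<and> sq_int f < \<infinity>"
  by (auto simp: square_integrable_def sq_int_def integrable_iff_bounded)

lemma L2_tendsto_iff: "L2_tendsto u f \<longleftrightarrow> (\<lambda>n. sq_int (\<lambda>x. u n x - f x)) \<longlonglongrightarrow> 0"
  by (simp add: L2_tendsto_def sq_int_def)

text \<open>Fatou's lemma for the squared moduli.\<close>

lemma sq_int_liminf_le:
  assumes [measurable]: "\<And>n. v n \<in> borel_measurable lebesgue"
    and "AE x in lebesgue. (\<lambda>n. v n x) \<longlonglongrightarrow> g x"
  shows "sq_int g \<le> liminf (\<lambda>n. sq_int (v n))"
proof -
  have "sq_int g = (\<integral>\<^sup>+x. liminf (\<lambda>n. ennreal ((norm (v n x))\<^sup>2)) \<partial>lebesgue)"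
    unfolding sq_int_def using assms(2)
    by (intro nn_integral_cong_AE, elim AE_mp, intro AE_I2 impI)
       (intro lim_imp_Liminf[symmetric] tendsto_ennrealI tendsto_intros, auto)
  also have "\<dots> \<le> liminf (\<lambda>n. sq_int (v n))"
    unfolding sq_int_def by (rule nn_integral_liminf) simp
  finally show ?thesis .
qed

text \<open>Dominated convergence for the squared differences, with the squared modulus of
  \<open>w\<close> as majorant.\<close>

lemma sq_int_dominated:
  assumes [measurable]: "\<And>n. v n \<in> borel_measurable lebesgue" "f \<in> borel_measurable lebesgue"
    and w [measurable]: "w \<in> borel_measurable lebesgue" and fin: "sq_int w < \<infinity>"
    and lim: "AE x in lebesgue. (\<lambda>n. v n x) \<longlonglongrightarrow> f x"
    and bd: "\<And>n x. norm (v n x - f x) \<le> norm (w x)"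
  shows "(\<lambda>n. sq_int (\<lambda>x. v n x - f x)) \<longlonglongrightarrow> 0"
proof -
  have "(\<lambda>n. \<integral>\<^sup>+x. ennreal ((norm (v n x - f x))\<^sup>2) \<partial>lebesgue) \<longlonglongrightarrow> (\<integral>\<^sup>+x. 0 \<partial>(lebesgue :: (real^2) measure))"
  proof (rule nn_integral_dominated_convergence[where w="\<lambda>x. ennreal ((norm (w x))\<^sup>2)"])
    show "AE x in lebesgue. ennreal ((norm (v n x - f x))\<^sup>2) \<le> ennreal ((norm (w x))\<^sup>2)" for n
      using bd by (auto intro!: AE_I2 ennreal_leI power_mono)
    show "AE x in lebesgue. (\<lambda>n. ennreal ((norm (v n x - f x))\<^sup>2)) \<longlonglongrightarrow> 0"
      using lim
    proof eventually_elim
      case (elim x)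
      then have "(\<lambda>n. (norm (v n x - f x))\<^sup>2) \<longlonglongrightarrow> (norm (f x - f x))\<^sup>2"
        by (intro tendsto_intros)
      then show ?case by (intro tendsto_ennrealI[of _ 0, simplified]) simp
    qed
  qed (use fin in \<open>auto simp: sq_int_def\<close>)
  then show ?thesis by (simp add: sq_int_def)
qed

text \<open>The Riesz-Fischer argument for a sequence with geometric Cauchy rate: the rate forces
  convergence almost everywhere, and Fatou's lemma passes the rate to the limit.\<close>

lemma L2_complete:
  assumes [measurable]: "\<And>n. v n \<in> borel_measurable lebesgue"
    and cauchy: "\<And>n m. n \<le> m \<Longrightarrow> sq_int (\<lambda>x. v n x - v m x) \<le> ennreal (C * (1/4)^n)" and C: "C \<ge> 0"
  obtains g where "g \<in> borel_measurable lebesgue" "\<And>n. sq_int (\<lambda>x. v n x - g x) \<le> ennreal (C * (1/4)^n)"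
proof -
  \<comment> \<open>The value of \<open>lim\<close> is unspecified at points of divergence; these
    turn out to form a null set.\<close>
  define g where "g x = lim (\<lambda>n. v n x)" for x
  have g [measurable]: "g \<in> borel_measurable lebesgue"
    unfolding g_def by measurable
  let ?d = "\<lambda>n x. (norm (v n x - v (Suc n) x))\<^sup>2"
  \<comment> \<open>The weight \<open>2^n\<close> against the decay \<open>(1/4)^n\<close> still
    leaves a summable series, and it makes the pointwise differences decay geometrically.\<close>
  have "(\<integral>\<^sup>+x. (\<Sum>n. ennreal (2^n * ?d n x)) \<partial>lebesgue) = (\<Sum>n. ennreal (2^n) * sq_int (\<lambda>x. v n x - v (Suc n) x))"
    by (subst nn_integral_suminf) (auto simp: sq_int_def ennreal_mult nn_integral_cmult)
  also have "\<dots> \<le> (\<Sum>n. ennreal (C * (1/2)^n))"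
  proof (intro suminf_le)
    show "ennreal (2^n) * sq_int (\<lambda>x. v n x - v (Suc n) x) \<le> ennreal (C * (1/2)^n)" for n
    proof -
      have "ennreal (2^n) * sq_int (\<lambda>x. v n x - v (Suc n) x) \<le> ennreal (2^n) * ennreal (C * (1/4)^n)"
        by (intro mult_left_mono cauchy) auto
      also have "\<dots> = ennreal (C * (1/2)^n)"
      proof -
        have "(2::real)^n * (1/4)^n = (1/2)^n" by (simp flip: power_mult_distrib)
        then show ?thesis using C by (simp add: mult.left_commute flip: ennreal_mult)
      qed
      finally show ?thesis .
    qed
  qed auto
  also have "\<dots> < \<infinity>"
    using C by (subst suminf_ennreal2) (auto intro!: summable_mult summable_geometric)
  finally have "AE x in lebesgue. (\<Sum>n. ennreal (2^n * ?d n x)) \<noteq> \<infinity>"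
    by (intro nn_integral_PInf_AE) auto
  then have lim: "AE x in lebesgue. (\<lambda>n. v n x) \<longlonglongrightarrow> g x"
  proof eventually_elim
    case (elim x)
    then have "summable (\<lambda>n. 2^n * ?d n x)"
      by (intro summable_suminf_not_top) auto
    then obtain K where K: "\<And>n. norm (2^n * ?d n x) \<le> K"
      using BseqD[OF summable_imp_Bseq] by blast
    \<comment> \<open>A bound \<open>K\<close> for the weighted terms gives, after a square root, a
      geometric majorant of ratio \<open>1 / sqrt 2\<close>.\<close>
    have "norm (v (Suc n) x - v n x) \<le> sqrt K * (1 / sqrt 2)^n" for n
    proof -
      have "?d n x \<le> K * (1/2)^n"
        using K[of n] by (simp add: field_simps)
      then have "norm (v n x - v (Suc n) x) \<le> sqrt (K * (1/2)^n)"
        by (rule real_le_rsqrt)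
      then show ?thesis
        by (simp add: real_sqrt_mult real_sqrt_power real_sqrt_divide norm_minus_commute)
    qed
    moreover have "summable (\<lambda>n. sqrt K * (1 / sqrt 2)^n)"
      by (intro summable_mult summable_geometric) simp
    ultimately have "summable (\<lambda>n. v (Suc n) x - v n x)"
      by (intro summable_comparison_test[where f = "\<lambda>n. v (Suc n) x - v n x" and g = "\<lambda>n. sqrt K * (1 / sqrt 2)^n"]) blast+
    then have "convergent (\<lambda>n. \<Sum>i<n. v (Suc i) x - v i x)"
      by (simp add: summable_iff_convergent)
    then have "convergent (\<lambda>n. v n x - v 0 x)"
      using sum_lessThan_telescope[of "\<lambda>n. v n x"] by simp
    then have "convergent (\<lambda>n. v n x)"
      by (simp add: convergent_diff_const_right_iff)
    then show ?case unfolding g_def by (simp add: convergent_LIMSEQ_iff)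
  qed
  have "sq_int (\<lambda>x. v n x - g x) \<le> ennreal (C * (1/4)^n)" for n
  proof -
    \<comment> \<open>Fatou's lemma in the second index \<open>m\<close>, with \<open>n\<close>
      fixed.\<close>
    have "sq_int (\<lambda>x. v n x - g x) \<le> liminf (\<lambda>m. sq_int (\<lambda>x. v n x - v m x))"
    proof (rule sq_int_liminf_le)
      show "AE x in lebesgue. (\<lambda>m. v n x - v m x) \<longlonglongrightarrow> v n x - g x"
        using lim by eventually_elim (intro tendsto_intros)
    qed simp
    also have "\<dots> \<le> liminf (\<lambda>m. ennreal (C * (1/4)^n))"
      by (intro Liminf_mono eventually_sequentiallyI cauchy)
    finally show ?thesis by (simp add: Liminf_const)
  qed
  with g show ?thesis by (rule that)
qed

section \<open>The Fourier integral on Schwartz functions\<close>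

lemma fourier_schwartz_eq: "fourier_schwartz = fourier_L1 (-1)"
  by (intro ext) (simp add: fourier_schwartz_def fourier_L1_def)

lemma inv_fourier_schwartz_eq: "inv_fourier_schwartz = fourier_L1 1"
  by (intro ext) (simp add: inv_fourier_schwartz_def fourier_L1_def inner_commute)

lemma fourier_L1_diff:
  assumes u: "integrable lebesgue u" and v: "integrable lebesgue v"
  shows "fourier_L1 s u \<xi> - fourier_L1 s v \<xi> = fourier_L1 s (\<lambda>x. u x - v x) \<xi>"
proof -
  have "integrable lebesgue (\<lambda>x. exp (\<i> * of_real (s * (x \<bullet> \<xi>))) * w x)" if w: "integrable lebesgue w" for w
  proof (rule Bochner_Integration.integrable_bound[OF w])
    have [measurable]: "w \<in> borel_measurable lebesgue" using w by auto
    have [measurable]: "(\<lambda>x. exp (\<i> * of_real (s * (x \<bullet> \<xi>)))) \<in> borel_measurable lebesgue"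
      by (rule measurable_completion) measurable
    show "(\<lambda>x. exp (\<i> * of_real (s * (x \<bullet> \<xi>))) * w x) \<in> borel_measurable lebesgue" by measurable
    show "AE x in lebesgue. norm (exp (\<i> * of_real (s * (x \<bullet> \<xi>))) * w x) \<le> norm (w x)"
      by (simp only: norm_mult norm_exp_i_times) simp
  qed
  then show ?thesis
    unfolding fourier_L1_def right_diff_distrib[symmetric]
    by (subst Bochner_Integration.integral_diff[symmetric]) (use u v in \<open>auto simp: right_diff_distrib\<close>)
qed

lemma sq_int_fourier_L1_diff_le:
  assumes u: "integrable lebesgue u" and v: "integrable lebesgue v" and s: "s\<^sup>2 = 1"
  shows "sq_int (\<lambda>\<xi>. fourier_L1 s u \<xi> - fourier_L1 s v \<xi>) \<le> sq_int (\<lambda>x. u x - v x)"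
  unfolding fourier_L1_diff[OF u v] using sq_int_fourier_L1_le[OF _ s, of "\<lambda>x. u x - v x"] u v by simp

text \<open>In the plane, the square of \<open>1 + (norm x)^2\<close> dominates the product of the
  factors \<open>1 + (x \<bullet> b)^2\<close>, whose reciprocal is a product of integrable
  functions of one variable.\<close>

lemma integrable_inverse_weight:
  "integrable lborel (\<lambda>x::real^2. inverse ((1 + (norm x)\<^sup>2)\<^sup>2))"
proof -
  have *: "integrable lborel (\<lambda>x::real. inverse (1 + x\<^sup>2))"
    using integrable_inverse_1_plus_square by (simp add: set_integrable_def einterval_def)
  have "integrable lborel (\<lambda>x::real^2. \<Prod>b\<in>Basis. complex_of_real (inverse (1 + (x \<bullet> b)\<^sup>2)))"
    using has_bochner_integral_lborel_prod[OF has_bochner_integral_of_real[OF has_bochner_integral_integrable[OF *]], where 'a="real^2"]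
    by (auto simp: has_bochner_integral_iff)
  then show ?thesis
  proof (rule Bochner_Integration.integrable_bound)
    show "AE x::real^2 in lborel. norm (inverse ((1 + (norm x)\<^sup>2)\<^sup>2)) \<le> norm (\<Prod>b\<in>Basis. complex_of_real (inverse (1 + (x \<bullet> b)\<^sup>2)))"
    proof (intro AE_I2)
      fix x :: "real^2"
      have "(\<Prod>b\<in>Basis. 1 + (x \<bullet> b)\<^sup>2) \<le> (\<Prod>b\<in>(Basis::(real^2) set). 1 + (norm x)\<^sup>2)"
        using Basis_le_norm[of _ x] by (intro prod_mono) (auto simp: abs_le_square_iff[symmetric])
      moreover have "(\<Prod>b\<in>Basis. 1 + (x \<bullet> b)\<^sup>2) > 0"
        by (intro prod_pos) (auto intro: add_pos_nonneg)
      ultimately have "inverse ((1 + (norm x)\<^sup>2)\<^sup>2) \<le> inverse (\<Prod>b\<in>Basis. 1 + (x \<bullet> b)\<^sup>2)"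
        by (intro le_imp_inverse_le) auto
      then show "norm (inverse ((1 + (norm x)\<^sup>2)\<^sup>2)) \<le> norm (\<Prod>b\<in>Basis. complex_of_real (inverse (1 + (x \<bullet> b)\<^sup>2)))"
        unfolding of_real_prod[symmetric] norm_of_real by (simp add: prod_inversef[symmetric] o_def)
    qed
  qed simp
qed

lemma schwartz_measurable: "schwartz f \<Longrightarrow> f \<in> borel_measurable borel"
  unfolding schwartz_def
  by (drule spec[of _ "[]"]) (auto intro!: borel_measurable_continuous_onI continuous_at_imp_continuous_on differentiable_imp_continuous_within)

text \<open>The empty list of directions with powers 0 and 4 bounds \<open>norm (f x)\<close> by a
  multiple of the integrable weight, since \<open>(1 + r^2)^2 \<le> 2 + 2 * r^4\<close>.\<close>

lemma schwartz_integrable: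
  assumes f: "schwartz f"
  shows "integrable lebesgue f"
proof -
  have m: "f \<in> borel_measurable borel" using schwartz_measurable[OF f] .
  have "bounded (range (\<lambda>x. norm x ^ k *\<^sub>R f x))" for k
    using f unfolding schwartz_def by (auto dest: spec[of _ "[]"])
  from this[of 0] this[of 4] obtain A B where A: "\<And>x. norm (f x) \<le> A" and B: "\<And>x. norm x ^ 4 * norm (f x) \<le> B"
    by (auto simp: bounded_iff)
  have "integrable lborel f"
  proof (rule Bochner_Integration.integrable_bound[OF integrable_mult_right[OF integrable_inverse_weight, of "2 * A + 2 * B"]])
    show "AE x in lborel. norm (f x) \<le> norm ((2 * A + 2 * B) * inverse ((1 + (norm x)\<^sup>2)\<^sup>2))"
    proof (intro AE_I2)
      fix x :: "real^2"
      have "(1 + (norm x)\<^sup>2)\<^sup>2 \<le> 2 + 2 * norm x ^ 4"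
        using sum_squares_bound[of 1 "(norm x)\<^sup>2"] by (simp add: power2_sum flip: power_mult)
      then have "norm (f x) * (1 + (norm x)\<^sup>2)\<^sup>2 \<le> norm (f x) * (2 + 2 * norm x ^ 4)"
        by (intro mult_left_mono) auto
      also have "\<dots> \<le> 2 * A + 2 * B"
        using A[of x] B[of x] by (simp add: distrib_left mult_ac)
      finally have "norm (f x) \<le> (2 * A + 2 * B) * inverse ((1 + (norm x)\<^sup>2)\<^sup>2)"
        by (subst divide_inverse[symmetric], subst pos_le_divide_eq) (intro zero_less_power add_pos_nonneg, auto)
      then show "norm (f x) \<le> norm ((2 * A + 2 * B) * inverse ((1 + (norm x)\<^sup>2)\<^sup>2))" by simp
    qed
  qed (use m in simp)
  then show ?thesis using m by (simp add: integrable_completion)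
qed

section \<open>Existence of the extension and agreement with the integral\<close>

text \<open>The contraction property makes the transforms of fast approximants a Cauchy sequence,
  and completeness supplies the limit. Density enters as a hypothesis, discharged later by
  \<open>schwartz_dense\<close>.\<close>

lemma L2_extension_ex:
  assumes dense: "\<And>e. e > 0 \<Longrightarrow> \<exists>u. schwartz u \<and> sq_int (\<lambda>x. u x - f x) < ennreal e"
    and f: "square_integrable f" and s: "s\<^sup>2 = 1"
  shows "\<exists>g. square_integrable g \<and> (\<exists>u. (\<forall>n. schwartz (u n)) \<and> L2_tendsto u f \<and> L2_tendsto (\<lambda>n. fourier_L1 s (u n)) g)"
proof -
  have [measurable]: "f \<in> borel_measurable lebesgue" using f by (simp add: square_integrable_iff)
  \<comment> \<open>The rate \<open>(1/4)^n\<close> is the one that \<open>L2_complete\<close> asks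
    for.\<close>
  have "\<exists>u. \<forall>n. schwartz (u n) \<and> sq_int (\<lambda>x. u n x - f x) < ennreal ((1/4)^n)"
    by (intro choice allI dense) simp
  then obtain u where u: "\<And>n. schwartz (u n)" and uf: "\<And>n. sq_int (\<lambda>x. u n x - f x) < ennreal ((1/4)^n)"
    by blast
  have int: "integrable lebesgue (u n)" for n by (intro schwartz_integrable u)
  have [measurable]: "u n \<in> borel_measurable lebesgue" for n using int by auto
  have "sq_int (\<lambda>x. fourier_L1 s (u n) x - fourier_L1 s (u m) x) \<le> ennreal (4 * (1/4)^n)" if "n \<le> m" for n m
  proof -
    have "sq_int (\<lambda>x. fourier_L1 s (u n) x - fourier_L1 s (u m) x) \<le> sq_int (\<lambda>x. u n x - u m x)"
      by (intro sq_int_fourier_L1_diff_le int s)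
    also have "\<dots> \<le> 2 * sq_int (\<lambda>x. u n x - f x) + 2 * sq_int (\<lambda>x. f x - u m x)"
      by (intro sq_int_triangle) auto
    also have "\<dots> \<le> 2 * ennreal ((1/4)^n) + 2 * ennreal ((1/4)^n)"
    proof (intro add_mono mult_left_mono)
      show "sq_int (\<lambda>x. u n x - f x) \<le> ennreal ((1/4)^n)" using uf[of n] by simp
      have "sq_int (\<lambda>x. f x - u m x) \<le> ennreal ((1/4)^m)" using uf[of m] sq_int_diff_commute[of f "u m"] by simp
      also have "\<dots> \<le> ennreal ((1/4)^n)" using that by (intro ennreal_leI power_decreasing) auto
      finally show "sq_int (\<lambda>x. f x - u m x) \<le> ennreal ((1/4)^n)" .
    qed auto
    also have "\<dots> = ennreal (4 * (1/4)^n)"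
      by (simp add: ennreal_mult distrib_right[symmetric])
    finally show ?thesis .
  qed
  then obtain g where g [measurable]: "g \<in> borel_measurable lebesgue"
    and le: "\<And>n. sq_int (\<lambda>x. fourier_L1 s (u n) x - g x) \<le> ennreal (4 * (1/4)^n)"
    using L2_complete[of "\<lambda>n. fourier_L1 s (u n)" 4] by auto
  have z: "(\<lambda>n. ennreal (c * (1/4)^n)) \<longlonglongrightarrow> 0" for c
    by (rule tendsto_ennrealI[of _ 0, simplified]) (intro tendsto_mult_right_zero LIMSEQ_power_zero, simp)
  have "L2_tendsto (\<lambda>n. fourier_L1 s (u n)) g"
    unfolding L2_tendsto_iff by (rule tendsto_sandwich[OF _ _ tendsto_const z[of 4]]) (auto simp: le)
  moreover have "L2_tendsto u f"
    unfolding L2_tendsto_iff by (rule tendsto_sandwich[OF _ _ tendsto_const z[of 1]]) (auto simp: less_imp_le[OF uf])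
  \<comment> \<open>\<open>g\<close> is at finite distance from the transform of \<open>u 0\<close>,
    which is controlled by \<open>u 0\<close> itself and hence by \<open>f\<close>.\<close>
  moreover have "sq_int g < \<infinity>"
  proof -
    have fin: "2 * x + 2 * y < \<infinity>" if "x < \<infinity>" "y < \<infinity>" for x y :: ennreal
      using that by (simp add: ennreal_mult_less_top)
    have "sq_int (u 0) \<le> 2 * sq_int (\<lambda>x. u 0 x - f x) + 2 * sq_int f"
      using sq_int_add_le[of "\<lambda>x. u 0 x - f x" f] by simp
    also have "\<dots> < \<infinity>" using uf[of 0] f by (intro fin) (auto simp: square_integrable_iff intro: less_trans)
    finally have "sq_int (fourier_L1 s (u 0)) < \<infinity>"
      using sq_int_fourier_L1_le[OF int s, of 0] by (rule le_less_trans[rotated])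
    moreover have "sq_int (\<lambda>x. g x - fourier_L1 s (u 0) x) < \<infinity>"
      using le[of 0] sq_int_diff_commute[of g "fourier_L1 s (u 0)"] by (auto intro: le_less_trans)
    ultimately have "2 * sq_int (\<lambda>x. g x - fourier_L1 s (u 0) x) + 2 * sq_int (fourier_L1 s (u 0)) < \<infinity>"
      by (intro fin)
    then show ?thesis
      using sq_int_add_le[of "\<lambda>x. g x - fourier_L1 s (u 0) x" "fourier_L1 s (u 0)"] by (auto intro: le_less_trans)
  qed
  ultimately show ?thesis using u g unfolding square_integrable_iff by blast
qed

text \<open>Existence makes the Hilbert choice in \<open>L2_extension\<close> meaningful, so the
  chosen representative has the properties that define it.\<close>

lemma L2_extension_fourier_L1_spec:
  assumes dense: "\<And>f e. square_integrable f \<Longrightarrow> e > 0 \<Longrightarrow> \<exists>u. schwartz u \<and> sq_int (\<lambda>x. u x - f x) < ennreal e"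
    and f: "square_integrable f" and s: "s\<^sup>2 = 1"
  shows "square_integrable (L2_extension (fourier_L1 s) f)"
    and "\<exists>u. (\<forall>n. schwartz (u n)) \<and> L2_tendsto u f \<and> L2_tendsto (\<lambda>n. fourier_L1 s (u n)) (L2_extension (fourier_L1 s) f)"
  using someI_ex[OF L2_extension_ex[OF dense[OF f] f s]] unfolding L2_extension_def by blast+

text \<open>Both sides are L2 limits of the transforms of the same Schwartz functions: the extension
  by its specification, the integral by the contraction property applied to
  \<open>u n - f\<close>.\<close>

lemma L2_extension_fourier_L1_eq:
  assumes dense: "\<And>f e. square_integrable f \<Longrightarrow> e > 0 \<Longrightarrow> \<exists>u. schwartz u \<and> sq_int (\<lambda>x. u x - f x) < ennreal e"
    and f: "square_integrable f" "integrable lebesgue f" and s: "s\<^sup>2 = 1"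
  shows "AE x in lebesgue. L2_extension (fourier_L1 s) f x = fourier_L1 s f x"
proof -
  let ?g = "L2_extension (fourier_L1 s) f"
  obtain u where u: "\<And>n. schwartz (u n)" and uf: "L2_tendsto u f" and ug: "L2_tendsto (\<lambda>n. fourier_L1 s (u n)) ?g"
    using L2_extension_fourier_L1_spec(2)[OF dense f(1) s] by blast
  have int: "integrable lebesgue (u n)" for n by (intro schwartz_integrable u)
  have [measurable]: "u n \<in> borel_measurable lebesgue" for n using int by auto
  have [measurable]: "?g \<in> borel_measurable lebesgue" "f \<in> borel_measurable lebesgue"
    using L2_extension_fourier_L1_spec(1)[OF dense f(1) s] f(1) by (auto simp: square_integrable_iff)
  let ?b = "\<lambda>n. 2 * sq_int (\<lambda>x. fourier_L1 s (u n) x - ?g x) + 2 * sq_int (\<lambda>x. u n x - f x)"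
  have "sq_int (\<lambda>x. ?g x - fourier_L1 s f x) \<le> ?b n" for n
  proof -
    have "sq_int (\<lambda>x. ?g x - fourier_L1 s f x) \<le> 2 * sq_int (\<lambda>x. ?g x - fourier_L1 s (u n) x) + 2 * sq_int (\<lambda>x. fourier_L1 s (u n) x - fourier_L1 s f x)"
      by (intro sq_int_triangle) auto
    also have "\<dots> \<le> ?b n"
      unfolding sq_int_diff_commute[of ?g] by (intro add_left_mono mult_left_mono sq_int_fourier_L1_diff_le int f s) auto
    finally show ?thesis .
  qed
  moreover have "?b \<longlonglongrightarrow> 2 * 0 + 2 * 0"
    using uf ug unfolding L2_tendsto_iff by (intro tendsto_add ennreal_tendsto_cmult) auto
  ultimately have "sq_int (\<lambda>x. ?g x - fourier_L1 s f x) \<le> 0"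
    by (intro LIMSEQ_le_const) auto
  then show ?thesis by (subst (asm) le_zero_eq, subst (asm) sq_int_eq_0) auto
qed

section \<open>Density of Schwartz functions\<close>

text \<open>A concrete class of Schwartz functions. The linear term \<open>b \<bullet> x\<close>
  encodes the centre of the Gaussian; letting centre and width vary makes the class closed under
  products.\<close>

inductive gauss_poly :: "(real^2 \<Rightarrow> complex) \<Rightarrow> bool" where
  gauss: "a > 0 \<Longrightarrow> gauss_poly (\<lambda>x. c * of_real (exp (b \<bullet> x - a * (norm x)\<^sup>2)))"
| add: "gauss_poly f \<Longrightarrow> gauss_poly g \<Longrightarrow> gauss_poly (\<lambda>x. f x + g x)"
| coord: "gauss_poly f \<Longrightarrow> gauss_poly (\<lambda>x. of_real (x $ i) * f x)"

lemma gauss_poly_cmult: "gauss_poly f \<Longrightarrow> gauss_poly (\<lambda>x. c * f x)"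
proof (induction rule: gauss_poly.induct)
  case (gauss a d b)
  then show ?case using gauss_poly.gauss[of a "c * d" b] by (simp add: mult.assoc)
next
  case (add f g)
  then show ?case using gauss_poly.add[OF add.IH] by (simp add: distrib_left)
next
  case (coord f i)
  then show ?case using gauss_poly.coord[OF coord.IH, of i] by (simp add: mult.left_commute)
qed

lemma gauss_poly_mult:
  assumes "gauss_poly f" "gauss_poly g"
  shows "gauss_poly (\<lambda>x. f x * g x)"
  using assms
proof (induction rule: gauss_poly.induct)
  case (gauss a c b)
  note a = this(1)
  show ?case using \<open>gauss_poly g\<close>
  proof (induction rule: gauss_poly.induct)
    case (gauss a' c' b')
    have "exp (b \<bullet> x - a * (norm x)\<^sup>2) * exp (b' \<bullet> x - a' * (norm x)\<^sup>2) = exp ((b + b') \<bullet> x - (a + a') * (norm x)\<^sup>2)" for x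
      by (simp add: exp_add[symmetric] inner_add_left algebra_simps)
    then have "c * of_real (exp (b \<bullet> x - a * (norm x)\<^sup>2)) * (c' * of_real (exp (b' \<bullet> x - a' * (norm x)\<^sup>2)))
      = (c * c') * of_real (exp ((b + b') \<bullet> x - (a + a') * (norm x)\<^sup>2))" for x
      by (metis (no_types, lifting) mult.assoc mult.left_commute of_real_mult)
    then show ?case using gauss_poly.gauss[of "a + a'" "c * c'" "b + b'"] a gauss by (simp only: add_pos_pos)
  next
    case (add f g)
    then show ?case using gauss_poly.add[OF add.IH] by (simp add: distrib_left)
  next
    case (coord f i)
    then show ?case using gauss_poly.coord[OF coord.IH, of i] by (simp add: mult.left_commute)
  qed
next
  case (add f h)
  then show ?case using gauss_poly.add[of "\<lambda>x. f x * g x" "\<lambda>x. h x * g x"] by (simp add: distrib_right)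
next
  case (coord f i)
  then show ?case using gauss_poly.coord[of "\<lambda>x. f x * g x" i] by (simp add: mult.assoc)
qed

text \<open>A Gaussian differentiates to a polynomial of degree at most one times itself, and the
  product rule handles coordinates. The full derivative is carried through the induction because
  \<open>partial_deriv\<close> evaluates \<open>frechet_derivative\<close> on axis vectors.\<close>

lemma gauss_poly_derivative:
  assumes "gauss_poly f"
  shows "\<exists>f'. (\<forall>x. (f has_derivative f' x) (at x)) \<and> (\<forall>i. gauss_poly (\<lambda>x. f' x (axis i 1)))"
  using assms
proof (induction rule: gauss_poly.induct)
  case (gauss a c b)
  let ?E = "\<lambda>x::real^2. exp (b \<bullet> x - a * (norm x)\<^sup>2)"
  have "((\<lambda>x. c * of_real (?E x)) has_derivative (\<lambda>h. c * of_real (?E x * (b \<bullet> h - 2 * a * (x \<bullet> h))))) (at x)" for x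
    unfolding power2_norm_eq_inner
    by (auto intro!: derivative_eq_intros simp: inner_commute)
  moreover have "gauss_poly (\<lambda>x. c * of_real (?E x * (b \<bullet> axis i 1 - 2 * a * (x \<bullet> axis i 1))))" for i
    using gauss_poly.add[OF gauss_poly.gauss[OF gauss, of "c * of_real (b $ i)" b] gauss_poly.coord[OF gauss_poly.gauss[OF gauss, of "c * of_real (- 2 * a)" b], of i]]
    by (simp add: inner_axis algebra_simps)
  ultimately show ?case
    by (intro exI[of _ "\<lambda>x h. c * of_real (?E x * (b \<bullet> h - 2 * a * (x \<bullet> h)))"] conjI allI)
next
  case (add f g)
  then obtain f' g' where "\<And>x. (f has_derivative f' x) (at x)" "\<And>i. gauss_poly (\<lambda>x. f' x (axis i 1))"
    "\<And>x. (g has_derivative g' x) (at x)" "\<And>i. gauss_poly (\<lambda>x. g' x (axis i 1))" by blast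
  then show ?case
    by (intro exI[of _ "\<lambda>x h. f' x h + g' x h"] conjI allI has_derivative_add gauss_poly.add)
next
  case (coord f i)
  then obtain f' where f': "\<And>x. (f has_derivative f' x) (at x)" "\<And>i. gauss_poly (\<lambda>x. f' x (axis i 1))" by blast
  have "((\<lambda>x. of_real (x $ i) * f x) has_derivative (\<lambda>h. of_real (x $ i) * f' x h + of_real (h $ i) * f x)) (at x)" for x
    by (intro has_derivative_mult f' has_derivative_of_real bounded_linear_imp_has_derivative bounded_linear_vec_nth)
  moreover have "gauss_poly (\<lambda>x. of_real (x $ i) * f' x (axis j 1) + of_real (axis j 1 $ i) * f x)" for j
    by (intro gauss_poly.add gauss_poly.coord gauss_poly_cmult f' coord)
  ultimately show ?case
    by (intro exI[of _ "\<lambda>x h. of_real (x $ i) * f' x h + of_real (h $ i) * f x"] conjI allI)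
qed

lemma gauss_poly_partial_deriv: "gauss_poly f \<Longrightarrow> gauss_poly (partial_deriv i f)"
  and gauss_poly_differentiable: "gauss_poly f \<Longrightarrow> f differentiable (at x)"
proof -
  assume f: "gauss_poly f"
  obtain f' where f': "\<And>x. (f has_derivative f' x) (at x)" "\<And>i. gauss_poly (\<lambda>x. f' x (axis i 1))"
    using gauss_poly_derivative[OF f] by blast
  then show "f differentiable (at x)" by (auto simp: differentiable_def)
  have "partial_deriv i f = (\<lambda>x. f' x (axis i 1))"
    using frechet_derivative_at[OF f'(1)] by (intro ext) (simp add: partial_deriv_def)
  then show "gauss_poly (partial_deriv i f)" using f'(2) by simp
qed

text \<open>The induction is over all powers \<open>k\<close> at once: a coordinate factor is at
  most \<open>norm x\<close> and raises the power by one.\<close>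

lemma gauss_poly_rapidly_decreasing:
  assumes "gauss_poly f"
  shows "\<exists>B. \<forall>x. norm x ^ k * norm (f x) \<le> B"
  using assms
proof (induction arbitrary: k rule: gauss_poly.induct)
  case (gauss a c b)
  have "norm x ^ k * norm (c * complex_of_real (exp (b \<bullet> x - a * (norm x)\<^sup>2))) \<le> norm c * exp ((k + norm b)\<^sup>2 / (4 * a))" for x
  proof -
    let ?r = "norm x"
    have "?r \<le> exp ?r" using exp_ge_add_one_self[of ?r] by linarith
    then have "?r ^ k \<le> exp ?r ^ k" by (intro power_mono) auto
    also have "\<dots> = exp (k * ?r)" by (simp add: exp_of_nat_mult)
    finally have "?r ^ k * exp (b \<bullet> x - a * ?r\<^sup>2) \<le> exp (k * ?r) * exp (norm b * ?r - a * ?r\<^sup>2)"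
      using norm_cauchy_schwarz[of b x] by (intro mult_mono) auto
    also have "\<dots> = exp ((k + norm b) * ?r - a * ?r\<^sup>2)"
      by (simp add: exp_add[symmetric] algebra_simps)
    also have "\<dots> \<le> exp ((k + norm b)\<^sup>2 / (4 * a))"
    proof -
      \<comment> \<open>Completing the square: \<open>(k + norm b) * r - a * r^2\<close> has maximum
        \<open>(k + norm b)^2 / (4 * a)\<close>.\<close>
      have "0 \<le> (2 * a * ?r - (k + norm b))\<^sup>2" by simp
      then have "4 * a * ((k + norm b) * ?r - a * ?r\<^sup>2) \<le> (k + norm b)\<^sup>2"
        by (simp add: power2_eq_square algebra_simps)
      then show ?thesis using gauss by (simp add: field_simps)
    qed
    finally show ?thesis
      by (simp add: norm_mult mult.left_commute mult_left_mono)
  qed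
  then show ?case by blast
next
  case (add f g)
  obtain B C where B: "\<And>x. norm x ^ k * norm (f x) \<le> B" "\<And>x. norm x ^ k * norm (g x) \<le> C"
    using add.IH[of k] by blast
  have "norm x ^ k * norm (f x + g x) \<le> B + C" for x
  proof -
    have "norm x ^ k * norm (f x + g x) \<le> norm x ^ k * norm (f x) + norm x ^ k * norm (g x)"
      by (simp add: distrib_left[symmetric] mult_left_mono norm_triangle_ineq)
    then show ?thesis using B[of x] by linarith
  qed
  then show ?case by blast
next
  case (coord f i)
  obtain B where B: "\<And>x. norm x ^ Suc k * norm (f x) \<le> B" using coord.IH by blast
  have "norm x ^ k * norm (complex_of_real (x $ i) * f x) \<le> B" for x
  proof -
    have "norm x ^ k * (\<bar>x $ i\<bar> * norm (f x)) \<le> norm x ^ k * (norm x * norm (f x))"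
      by (intro mult_left_mono mult_right_mono component_le_norm_cart) auto
    then show ?thesis using B[of x] by (simp add: norm_mult mult_ac)
  qed
  then show ?case by blast
qed

lemma gauss_poly_schwartz:
  assumes "gauss_poly f"
  shows "schwartz f"
proof -
  have "gauss_poly (foldr partial_deriv is f)" for "is"
    by (induction "is") (auto intro: assms gauss_poly_partial_deriv)
  then show ?thesis unfolding schwartz_def
    using gauss_poly_differentiable gauss_poly_rapidly_decreasing by (fastforce simp: bounded_iff)
qed

lemma gauss_poly_bounded: "gauss_poly f \<Longrightarrow> \<exists>B. \<forall>x. norm (f x) \<le> B"
  using gauss_poly_rapidly_decreasing[of f 0] by simp

lemma gauss_poly_measurable [measurable_dest]: "gauss_poly f \<Longrightarrow> f \<in> borel_measurable lebesgue"
  using schwartz_measurable[OF gauss_poly_schwartz] by (intro measurable_completion) simp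

lemma gauss_poly_sq_int:
  assumes f: "gauss_poly f"
  shows "sq_int f < \<infinity>"
proof -
  have [measurable]: "f \<in> borel_measurable lebesgue" using f by (rule gauss_poly_measurable)
  obtain B where B: "\<And>x. norm (f x) \<le> B" using gauss_poly_bounded[OF f] by blast
  have "integrable lebesgue (\<lambda>x. (norm (f x))\<^sup>2)"
  proof (rule Bochner_Integration.integrable_bound[OF integrable_mult_right[OF integrable_norm[OF schwartz_integrable[OF gauss_poly_schwartz[OF f]]], of B]])
    show "AE x in lebesgue. norm ((norm (f x))\<^sup>2) \<le> norm (B * norm (f x))"
      using B by (intro AE_I2) (auto simp: power2_eq_square abs_mult intro!: mult_right_mono order_trans[OF B])
  qed simp
  then have "square_integrable f" by (simp add: square_integrable_def)
  then show ?thesis by (simp add: square_integrable_iff)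
qed

section \<open>The L2 closure of the Gaussian polynomials\<close>

text \<open>The closure is studied as a class of functions in order to show that it contains every
  square-integrable function.\<close>

definition approximable :: "(real^2 \<Rightarrow> complex) \<Rightarrow> bool" where
  "approximable f \<longleftrightarrow> f \<in> borel_measurable lebesgue \<and>
     (\<forall>e>0. \<exists>u. gauss_poly u \<and> sq_int (\<lambda>x. u x - f x) \<le> ennreal e)"

lemma approximable_measurable [measurable_dest]: "approximable f \<Longrightarrow> f \<in> borel_measurable lebesgue"
  by (simp add: approximable_def)

lemma gauss_poly_approximable: "gauss_poly f \<Longrightarrow> approximable f"
  unfolding approximable_def
  by (auto intro!: gauss_poly_measurable exI[of _ f] simp: sq_int_def)

lemma ennreal_quarters: "0 \<le> e \<Longrightarrow> 2 * ennreal (e / 4) + 2 * ennreal (e / 4) = ennreal e"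
proof -
  assume e: "0 \<le> e"
  have "2 * ennreal (e / 4) = ennreal (2 * (e / 4))"
    using e by (subst ennreal_mult) auto
  then show ?thesis using e by (simp flip: ennreal_plus)
qed

lemma approximable_closed:
  assumes [measurable]: "f \<in> borel_measurable lebesgue"
    and close: "\<And>e. e > 0 \<Longrightarrow> \<exists>g. approximable g \<and> sq_int (\<lambda>x. g x - f x) \<le> ennreal e"
  shows "approximable f"
  unfolding approximable_def
proof (intro conjI allI impI)
  fix e :: real assume "e > 0"
  \<comment> \<open>Two errors of \<open>e / 4\<close>, each doubled by
    \<open>sq_int_triangle\<close>, add up to \<open>e\<close>.\<close>
  then obtain g where g: "approximable g" "sq_int (\<lambda>x. g x - f x) \<le> ennreal (e / 4)"
    using close[of "e / 4"] by auto
  then obtain u where u: "gauss_poly u" "sq_int (\<lambda>x. u x - g x) \<le> ennreal (e / 4)"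
    using \<open>e > 0\<close> unfolding approximable_def by (metis divide_pos_pos zero_less_numeral)
  have [measurable]: "u \<in> borel_measurable lebesgue" "g \<in> borel_measurable lebesgue"
    using u g by (auto intro: gauss_poly_measurable approximable_measurable)
  have "sq_int (\<lambda>x. u x - f x) \<le> 2 * sq_int (\<lambda>x. u x - g x) + 2 * sq_int (\<lambda>x. g x - f x)"
    by (intro sq_int_triangle) auto
  also have "\<dots> \<le> 2 * ennreal (e / 4) + 2 * ennreal (e / 4)"
    using u g by (intro add_mono mult_left_mono) auto
  also have "\<dots> = ennreal e" using \<open>e > 0\<close> by (simp add: ennreal_quarters)
  finally show "\<exists>u. gauss_poly u \<and> sq_int (\<lambda>x. u x - f x) \<le> ennreal e"
    using u by auto
qed fact

lemma approximable_limit: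
  assumes f: "f \<in> borel_measurable lebesgue" and g: "\<And>n. approximable (g n)"
    and lim: "(\<lambda>n. sq_int (\<lambda>x. g n x - f x)) \<longlonglongrightarrow> 0"
  shows "approximable f"
proof (rule approximable_closed[OF f])
  fix e :: real assume "e > 0"
  then have "eventually (\<lambda>n. sq_int (\<lambda>x. g n x - f x) < ennreal e) sequentially"
    by (intro order_tendstoD(2)[OF lim]) simp
  then obtain n where "sq_int (\<lambda>x. g n x - f x) < ennreal e"
    by (auto simp: eventually_sequentially)
  then show "\<exists>g. approximable g \<and> sq_int (\<lambda>x. g x - f x) \<le> ennreal e"
    using g by (intro exI[of _ "g n"]) auto
qed

lemma approximable_cong_AE:
  assumes f: "approximable f" and g: "g \<in> borel_measurable lebesgue" and eq: "AE x in lebesgue. f x = g x"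
  shows "approximable g"
proof (rule approximable_limit[OF g, of "\<lambda>_. f"])
  have "sq_int (\<lambda>x. f x - g x) = sq_int (\<lambda>_. 0)"
    using eq by (intro sq_int_cong_AE) auto
  then show "(\<lambda>n::nat. sq_int (\<lambda>x. f x - g x)) \<longlonglongrightarrow> 0" by (simp add: sq_int_def)
qed (rule f)

lemma approximable_add:
  assumes f: "approximable f" and g: "approximable g"
  shows "approximable (\<lambda>x. f x + g x)"
proof (rule approximable_closed)
  have [measurable]: "f \<in> borel_measurable lebesgue" "g \<in> borel_measurable lebesgue"
    using f g by (auto intro: approximable_measurable)
  show "(\<lambda>x. f x + g x) \<in> borel_measurable lebesgue" by measurable
  fix e :: real assume e: "e > 0"
  obtain u v where u: "gauss_poly u" "sq_int (\<lambda>x. u x - f x) \<le> ennreal (e / 4)"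
    and v: "gauss_poly v" "sq_int (\<lambda>x. v x - g x) \<le> ennreal (e / 4)"
    using f g e unfolding approximable_def by (metis divide_pos_pos zero_less_numeral)
  have [measurable]: "u \<in> borel_measurable lebesgue" "v \<in> borel_measurable lebesgue"
    using u v by (auto intro: gauss_poly_measurable)
  have "sq_int (\<lambda>x. (u x - f x) + (v x - g x)) \<le> 2 * sq_int (\<lambda>x. u x - f x) + 2 * sq_int (\<lambda>x. v x - g x)"
    by (intro sq_int_add_le) auto
  also have "\<dots> \<le> 2 * ennreal (e / 4) + 2 * ennreal (e / 4)"
    using u v by (intro add_mono mult_left_mono) auto
  also have "\<dots> = ennreal e" using e by (simp add: ennreal_quarters)
  finally have "sq_int (\<lambda>x. (u x + v x) - (f x + g x)) \<le> ennreal e"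
    by (simp add: algebra_simps)
  then show "\<exists>h. approximable h \<and> sq_int (\<lambda>x. h x - (f x + g x)) \<le> ennreal e"
    using u v by (intro exI[of _ "\<lambda>x. u x + v x"] conjI gauss_poly_approximable gauss_poly.add) auto
qed

lemma sq_int_bounded_mult_le:
  assumes [measurable]: "g \<in> borel_measurable lebesgue" and f: "\<And>x. norm (f x) \<le> K"
  shows "sq_int (\<lambda>x. f x * g x) \<le> ennreal (K\<^sup>2) * sq_int g"
proof -
  have "sq_int (\<lambda>x. f x * g x) \<le> (\<integral>\<^sup>+x. ennreal (K\<^sup>2) * ennreal ((norm (g x))\<^sup>2) \<partial>lebesgue)"
    unfolding sq_int_def
    by (intro nn_integral_mono)
       (auto simp: norm_mult power_mult_distrib ennreal_mult[symmetric] intro!: ennreal_leI mult_right_mono power_mono f)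
  then show ?thesis by (simp add: sq_int_def nn_integral_cmult)
qed

text \<open>Multiplication by a bounded function is continuous in L2, so it suffices to control it
  on the dense class of Gaussian polynomials.\<close>

lemma approximable_bounded_mult:
  assumes K: "\<And>x. norm (h x) \<le> K" and f: "approximable f" and h [measurable]: "h \<in> borel_measurable lebesgue"
    and hu: "\<And>u. gauss_poly u \<Longrightarrow> approximable (\<lambda>x. h x * u x)"
  shows "approximable (\<lambda>x. h x * f x)"
proof (rule approximable_closed)
  have [measurable]: "f \<in> borel_measurable lebesgue" using f by (rule approximable_measurable)
  show "(\<lambda>x. h x * f x) \<in> borel_measurable lebesgue" by measurable
  fix e :: real assume e: "e > 0"
  have K1: "K\<^sup>2 + 1 > 0" by (simp add: add_nonneg_pos)
  \<comment> \<open>Dividing by \<open>K^2 + 1\<close> instead of \<open>K^2\<close> covers the case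
    \<open>K = 0\<close>.\<close>
  then obtain u where u: "gauss_poly u" "sq_int (\<lambda>x. u x - f x) \<le> ennreal (e / (K\<^sup>2 + 1))"
    using f e unfolding approximable_def by (metis divide_pos_pos)
  have [measurable]: "u \<in> borel_measurable lebesgue" using u by (auto intro: gauss_poly_measurable)
  have "sq_int (\<lambda>x. h x * (u x - f x)) \<le> ennreal (K\<^sup>2) * sq_int (\<lambda>x. u x - f x)"
    by (intro sq_int_bounded_mult_le K) auto
  also have "\<dots> \<le> ennreal (K\<^sup>2) * ennreal (e / (K\<^sup>2 + 1))" by (intro mult_left_mono u) auto
  also have "\<dots> = ennreal (K\<^sup>2 * (e / (K\<^sup>2 + 1)))" using e K1 by (subst ennreal_mult[symmetric]) auto
  also have "\<dots> \<le> ennreal e" using e K1 by (intro ennreal_leI) (simp add: field_simps)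
  finally show "\<exists>g. approximable g \<and> sq_int (\<lambda>x. g x - h x * f x) \<le> ennreal e"
    using hu[OF u(1)] by (intro exI[of _ "\<lambda>x. h x * u x"]) (simp add: right_diff_distrib)
qed

text \<open>Two uses of \<open>approximable_bounded_mult\<close>: with multiplier \<open>f\<close>
  it reduces \<open>g\<close> to a Gaussian polynomial \<open>u\<close>; with the bounded multiplier
  \<open>u\<close> it then reduces \<open>f\<close> to one as well.\<close>

lemma approximable_mult:
  assumes f: "approximable f" "\<And>x. norm (f x) \<le> K" and g: "approximable g"
  shows "approximable (\<lambda>x. f x * g x)"
proof (rule approximable_bounded_mult[OF f(2) g])
  show "f \<in> borel_measurable lebesgue" using f(1) by (rule approximable_measurable)
  fix u assume u: "gauss_poly u"
  obtain B where "\<And>x. norm (u x) \<le> B" using gauss_poly_bounded[OF u] by blast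
  then have "approximable (\<lambda>x. u x * f x)"
    using f(1) by (rule approximable_bounded_mult) (auto intro: u gauss_poly_measurable gauss_poly_approximable gauss_poly_mult)
  then show "approximable (\<lambda>x. f x * u x)" by (simp add: mult.commute)
qed

lemma approximable_cmult:
  assumes f: "approximable f"
  shows "approximable (\<lambda>x. c * f x)"
  by (rule approximable_bounded_mult[OF _ f, of "\<lambda>_. c" "norm c"]) (auto intro: gauss_poly_approximable gauss_poly_cmult)

lemma approximable_0: "approximable (\<lambda>_. 0)"
  using gauss_poly_approximable[OF gauss_poly.gauss[of 1 0]] by simp

lemma approximable_sum: "(\<And>i. i \<in> I \<Longrightarrow> approximable (f i)) \<Longrightarrow> approximable (\<lambda>x. \<Sum>i\<in>I. f i x)"
  by (induction I rule: infinite_finite_induct) (auto intro: approximable_0 approximable_add)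

section \<open>Indicator functions of balls\<close>

text \<open>The constants cancel, which leaves a polynomial in \<open>h\<close> without constant
  term; such polynomials stay in the class.\<close>

lemma gauss_poly_one_minus_power:
  assumes "gauss_poly h"
  shows "gauss_poly (\<lambda>x. 1 - (1 - h x) ^ Suc m)"
proof (induction m)
  case 0
  then show ?case using assms by simp
next
  case (Suc m)
  have "1 - (1 - h x) ^ Suc (Suc m) = (1 - (1 - h x) ^ Suc m) + (h x + (-1) * (h x * (1 - (1 - h x) ^ Suc m)))" for x
    by (simp add: algebra_simps)
  then show ?case
    using gauss_poly.add[OF Suc gauss_poly.add[OF assms gauss_poly_cmult[OF gauss_poly_mult[OF assms Suc], of "-1"]]]
    by (simp only:)
qed

text \<open>
  The polynomials \<open>1 - (1 - s\<^sup>n)^(2\<^sup>n)\<close> have no constant term and converge on \<open>[0, 1]\<close>, away from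
  \<open>s = 1/2\<close>, to the indicator function of \<open>s > 1/2\<close>, as in the Brosowski--Deutsch proof of the
  Stone--Weierstrass theorem.
\<close>

lemma
  fixes s :: real
  assumes s: "0 \<le> s" "s \<le> 1"
  defines "w \<equiv> (\<lambda>n::nat. 1 - (1 - s ^ n) ^ (2 ^ n))"
  shows step_polynomial_le: "n > 0 \<Longrightarrow> \<bar>w n - (if s > 1/2 then 1 else 0)\<bar> \<le> 2 * s"
    and step_polynomial_tendsto: "s \<noteq> 1/2 \<Longrightarrow> w \<longlonglongrightarrow> (if s > 1/2 then 1 else 0)"
proof -
  have sn: "0 \<le> s ^ n" "s ^ n \<le> 1" for n using s by (auto intro: power_le_one)
  have w01: "0 \<le> w n" "w n \<le> 1" for n
    using sn[of n] by (auto simp: w_def intro!: power_le_one)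
  \<comment> \<open>Bernoulli's inequality: \<open>(1 - s^n)^(2^n)\<close> is at least
    \<open>1 - 2^n * s^n\<close>.\<close>
  have le: "w n \<le> (2 * s) ^ n" for n
    using Bernoulli_inequality[of "- (s ^ n)" "2 ^ n"] sn[of n]
    by (simp add: w_def power_mult_distrib)
  show "\<bar>w n - (if s > 1/2 then 1 else 0)\<bar> \<le> 2 * s" if n: "n > 0"
  proof (cases "s > 1/2")
    case True
    then show ?thesis using w01[of n] by auto
  next
    case False
    have "(2 * s) ^ n \<le> (2 * s) ^ 1"
      using False s n by (intro power_decreasing) auto
    then show ?thesis using False w01[of n] le[of n] by simp
  qed
  show "w \<longlonglongrightarrow> (if s > 1/2 then 1 else 0)" if "s \<noteq> 1/2"
  proof (cases "s > 1/2")
    case False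
    then have "2 * s < 1" using that by simp
    then have "(\<lambda>n. (2 * s) ^ n) \<longlonglongrightarrow> 0" using s by (intro LIMSEQ_power_zero) auto
    then have "w \<longlonglongrightarrow> 0"
      by (rule tendsto_sandwich[OF _ _ tendsto_const, rotated 2]) (intro always_eventually allI w01 le)+
    then show ?thesis using False by simp
  next
    case True
    \<comment> \<open>Here \<open>1 - y \<le> exp (- y)\<close> with \<open>y = s^n\<close> is
      raised to the power \<open>2^n\<close>; the exponent tends to minus infinity when
      \<open>2 * s > 1\<close>.\<close>
    have "1 - exp (- ((2 * s) ^ n)) \<le> w n" for n
    proof -
      have "(1 - s ^ n) ^ (2 ^ n) \<le> exp (- (s ^ n)) ^ (2 ^ n)"
        using exp_ge_add_one_self[of "- (s ^ n)"] sn[of n] by (intro power_mono) auto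
      also have "\<dots> = exp (- ((2 * s) ^ n))"
        by (simp add: exp_of_nat_mult[symmetric] power_mult_distrib)
      finally show ?thesis by (simp add: w_def)
    qed
    moreover have "(\<lambda>n. 1 - exp (- ((2 * s) ^ n))) \<longlonglongrightarrow> 1"
    proof -
      have "filterlim (\<lambda>n. (2 * s) ^ n) at_top sequentially"
        using True s by (intro filterlim_at_infinity_imp_filterlim_at_top[OF filterlim_realpow_sequentially_gt1]) auto
      then have "(\<lambda>n. exp (- ((2 * s) ^ n))) \<longlonglongrightarrow> 0"
        by (intro filterlim_compose[OF exp_at_bot]) (simp add: filterlim_uminus_at_top[symmetric])
      then show ?thesis using tendsto_diff[OF tendsto_const[of 1]] by fastforce
    qed
    ultimately have "w \<longlonglongrightarrow> 1"
      by (intro tendsto_sandwich[OF _ _ _ tendsto_const, of _ w] always_eventually allI w01)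
    then show ?thesis using True by simp
  qed
qed

lemma gauss_poly_centered:
  assumes "a > 0"
  shows "gauss_poly (\<lambda>x. of_real (exp (- a * (norm (x - c))\<^sup>2)))"
proof -
  have "exp (- a * (norm (x - c))\<^sup>2) = exp (- a * (norm c)\<^sup>2) * exp ((2 * a) *\<^sub>R c \<bullet> x - a * (norm x)\<^sup>2)" for x
    by (simp add: exp_add[symmetric] power2_norm_eq_inner inner_diff_left inner_diff_right inner_commute algebra_simps)
  then show ?thesis
    using gauss_poly.gauss[OF assms, of "of_real (exp (- a * (norm c)\<^sup>2))" "(2 * a) *\<^sub>R c"]
    by (simp only: of_real_mult)
qed

text \<open>A ball is a superlevel set of a Gaussian about its centre. Applying the step polynomials
  to that Gaussian gives Gaussian polynomials that converge to the indicator off the bounding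
  sphere, a null set.\<close>

lemma approximable_ball:
  assumes r: "r > 0"
  shows "approximable (indicator (ball c r))"
proof -
  \<comment> \<open>Chosen so that the Gaussian \<open>s\<close> takes the value 1/2 exactly on the
    sphere of radius \<open>r\<close>.\<close>
  define a where "a = ln 2 / r\<^sup>2"
  have a: "a > 0" using r by (simp add: a_def)
  define s where "s x = exp (- a * (norm (x - c))\<^sup>2)" for x :: "real^2"
  have s: "0 \<le> s x" "s x \<le> 1" for x using a by (auto simp: s_def)
  have s_iff: "s x > 1/2 \<longleftrightarrow> x \<in> ball c r" "s x = 1/2 \<longleftrightarrow> x \<in> sphere c r" for x
  proof -
    have half: "1/2 = exp (- a * r\<^sup>2)" using r by (simp add: a_def exp_minus)
    show "s x > 1/2 \<longleftrightarrow> x \<in> ball c r" unfolding half s_def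
      using a r by (simp add: dist_norm norm_minus_commute abs_le_square_iff[symmetric] power_mono_iff not_le[symmetric] del: not_le)
    show "s x = 1/2 \<longleftrightarrow> x \<in> sphere c r" unfolding half s_def
      using a r by (simp add: dist_norm norm_minus_commute power2_eq_iff_nonneg)
  qed
  \<comment> \<open>The index starts at \<open>Suc n\<close> because the majorant
    \<open>2 * s\<close> holds for positive exponents: at exponent 0 the polynomial is constantly
    1.\<close>
  define w where "w n x = complex_of_real (1 - (1 - s x ^ Suc n) ^ (2 ^ Suc n))" for n x
  have w: "gauss_poly (w n)" for n
  proof -
    have "s x ^ Suc n = exp (- (real (Suc n) * a) * (norm (x - c))\<^sup>2)" for x
      by (simp only: s_def exp_of_nat_mult[symmetric]) (simp add: algebra_simps)
    moreover obtain m where m: "(2::nat) ^ Suc n = Suc m" by (metis not0_implies_Suc power_not_zero zero_neq_numeral)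
    ultimately show ?thesis
      using gauss_poly_one_minus_power[OF gauss_poly_centered[of "real (Suc n) * a" c], of m] a
      unfolding w_def m by simp
  qed
  have ind: "indicator (ball c r) x = complex_of_real (if s x > 1/2 then 1 else 0)" for x
    unfolding s_iff by (simp add: indicator_def)
  have meas: "(indicator (ball c r) :: real^2 \<Rightarrow> complex) \<in> borel_measurable lebesgue"
    by (intro measurable_completion borel_measurable_indicator) simp
  have "(\<lambda>n. sq_int (\<lambda>x. w n x - indicator (ball c r) x)) \<longlonglongrightarrow> 0"
  \<comment> \<open>The majorant \<open>2 * s\<close> is itself a Gaussian polynomial, hence
    square-integrable on the whole plane.\<close>
  proof (rule sq_int_dominated[where w="\<lambda>x. 2 * of_real (s x)"])
    have g: "gauss_poly (\<lambda>x. 2 * of_real (s x))"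
      unfolding s_def by (intro gauss_poly_cmult gauss_poly_centered a)
    show "(\<lambda>x. 2 * complex_of_real (s x)) \<in> borel_measurable lebesgue" by (rule gauss_poly_measurable[OF g])
    show "sq_int (\<lambda>x. 2 * of_real (s x)) < \<infinity>" by (rule gauss_poly_sq_int[OF g])
    show "norm (w n x - indicator (ball c r) x) \<le> norm (2 * complex_of_real (s x))" for n x
      unfolding ind w_def of_real_diff[symmetric] norm_of_real
      using step_polynomial_le[OF s, of "Suc n" x] s[of x] by (simp add: norm_mult)
    have "AE x in lebesgue. x \<notin> sphere c r"
      using negligible_sphere[of c r] by (intro AE_not_in) (simp add: negligible_iff_null_sets)
    then show "AE x in lebesgue. (\<lambda>n. w n x) \<longlonglongrightarrow> indicator (ball c r) x"
    proof eventually_elim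
      case (elim x)
      then have "s x \<noteq> 1/2" unfolding s_iff .
      from LIMSEQ_Suc[OF step_polynomial_tendsto[OF s this]] show ?case
        unfolding ind w_def by (intro tendsto_of_real)
    qed
  qed (auto intro: meas gauss_poly_measurable w)
  then show ?thesis
    by (rule approximable_limit[OF meas gauss_poly_approximable[OF w]])
qed

section \<open>From balls to Lebesgue sets of finite measure\<close>

text \<open>By the Lindelof property, an open set is a countable union of the balls that it
  contains.\<close>

lemma sets_borel_eq_sigma_balls: "sets (borel :: 'a::{metric_space, second_countable_topology} measure) = sigma_sets UNIV {ball c r |c r. r > 0}"
proof -
  have "S \<in> sigma_sets UNIV {ball c r |c r. r > 0}" if S: "open S" for S :: "'a set"
  proof -
    obtain F where F: "F \<subseteq> {ball c r |c r. r > 0 \<and> ball c r \<subseteq> S}" "countable F" "\<Union>F = \<Union>{ball c r |c r. r > 0 \<and> ball c r \<subseteq> S}"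
      by (rule Lindelof[of "{ball c r |c r. r > 0 \<and> ball c r \<subseteq> S}"]) auto
    have "\<Union>{ball c r |c r. r > 0 \<and> ball c r \<subseteq> S} = S"
    proof (intro equalityI subsetI)
      fix x assume "x \<in> S"
      then obtain r where "r > 0" "ball x r \<subseteq> S" using S by (auto simp: open_contains_ball)
      then show "x \<in> \<Union>{ball c r |c r. r > 0 \<and> ball c r \<subseteq> S}"
        by (intro UnionI[of "ball x r"]) auto
    qed auto
    moreover have "\<Union>F \<in> sigma_sets UNIV {ball c r |c r. r > 0}"
      using F by (intro sigma_sets_UNION sigma_sets.Basic) blast+
    ultimately show ?thesis using F by simp
  qed
  then show ?thesis
    unfolding sets_borel by (intro sigma_sets_eqI) auto
qed

lemma sq_int_indicator: "A \<in> sets lebesgue \<Longrightarrow> sq_int (indicator A) = emeasure lebesgue A"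
proof -
  have "ennreal ((norm (indicator A x :: complex))\<^sup>2) = indicator A x" for x
    by (simp add: indicator_def)
  then show "A \<in> sets lebesgue \<Longrightarrow> sq_int (indicator A) = emeasure lebesgue A"
    by (simp add: sq_int_def)
qed

text \<open>Dominated convergence, with the indicator of the whole union as majorant; finite measure
  makes it square-integrable.\<close>

lemma approximable_indicator_Union:
  assumes A: "\<And>n. A n \<in> sets lebesgue" "incseq A" and ap: "\<And>n. approximable (indicator (A n))"
    and fin: "emeasure lebesgue (\<Union>n. A n) < \<infinity>"
  shows "approximable (indicator (\<Union>n. A n))"
proof (rule approximable_limit[OF _ ap])
  have [measurable]: "A n \<in> sets lebesgue" for n by (rule A)
  show m: "(indicator (\<Union>n. A n) :: _ \<Rightarrow> complex) \<in> borel_measurable lebesgue" by measurable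
  show "(\<lambda>n. sq_int (\<lambda>x. indicator (A n) x - indicator (\<Union>n. A n) x)) \<longlonglongrightarrow> 0"
  proof (rule sq_int_dominated[where w="indicator (\<Union>n. A n)"])
    show "AE x in lebesgue. (\<lambda>n. indicator (A n) x) \<longlonglongrightarrow> (indicator (\<Union>n. A n) x :: complex)"
      using A(2) by (intro AE_I2 LIMSEQ_indicator_incseq)
    show "norm (indicator (A n) x - indicator (\<Union>n. A n) x :: complex) \<le> norm (indicator (\<Union>n. A n) x :: complex)" for n x
      by (auto simp: indicator_def)
  qed (use fin in \<open>auto simp: sq_int_indicator\<close>)
qed

text \<open>Dynkin's pi-lambda argument. Cutting by a fixed ball keeps all measures finite, so
  complements remain within reach.\<close>

lemma approximable_indicator_borel_ball:
  assumes A: "A \<in> sets borel" and R: "R > 0"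
  shows "approximable (indicator (A \<inter> ball 0 R))"
proof -
  \<comment> \<open>Balls alone are not stable under intersection. All approximable Borel sets are,
    since the indicator of an intersection is a product of bounded approximable functions.\<close>
  define G where "G = {A \<in> sets borel. approximable (indicator A)}"
  have Int: "approximable (indicator (A \<inter> B))" if "approximable (indicator A)" "approximable (indicator B)" for A B
  proof -
    have "indicator (A \<inter> B) = (\<lambda>x. indicator A x * indicator B x :: complex)"
      by (auto simp: indicator_def)
    moreover have "norm (indicator A x :: complex) \<le> 1" for x by (simp add: indicator_def)
    ultimately show ?thesis using approximable_mult[OF that(1) _ that(2)] by metis
  qed
  have "Int_stable G"
    unfolding Int_stable_def G_def by (auto intro: Int)
  moreover have "G \<subseteq> Pow UNIV" by simp
  moreover have "{ball c r |c r. r > 0} \<subseteq> G"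
    by (auto simp: G_def approximable_ball)
  then have "A \<in> sigma_sets UNIV G"
    using A sigma_sets_subseteq unfolding sets_borel_eq_sigma_balls by blast
  ultimately show ?thesis
  proof (induction rule: sigma_sets_induct_disjoint)
    case (basic A)
    then show ?case using R by (intro Int) (auto simp: G_def approximable_ball)
  next
    case empty
    show ?case using approximable_0 by (simp add: indicator_def)
  next
    case (compl A)
    \<comment> \<open>The complement is taken relative to the ball, which turns it into a difference
      of approximable indicators.\<close>
    have "indicator ((UNIV - A) \<inter> ball 0 R) = (\<lambda>x. indicator (ball 0 R) x + (-1) * indicator (A \<inter> ball 0 R) x :: complex)"
      by (auto simp: indicator_def)
    then show ?case
      using approximable_add[OF approximable_ball[OF R] approximable_cmult[OF compl(2)]] by (simp only:)
  next
    case (union A)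
    have sub: "sigma_sets UNIV G \<subseteq> sets borel"
      by (intro sets.sigma_sets_subset[of _ borel, simplified]) (auto simp: G_def)
    then have A [measurable]: "A i \<in> sets borel" for i using union(2) by auto
    \<comment> \<open>Partial unions are increasing, and by disjointness their indicators are finite
      sums; the limit is left to \<open>approximable_indicator_Union\<close>.\<close>
    have UN: "(\<Union>n. \<Union>i<n. A i \<inter> ball 0 R) = (\<Union>i. A i) \<inter> ball 0 R" by auto
    have "approximable (indicator (\<Union>n. \<Union>i<n. A i \<inter> ball 0 R))"
    proof (rule approximable_indicator_Union)
      have "(\<Union>i<n. A i \<inter> ball 0 R) \<in> sets lborel" for n by simp
      then show "(\<Union>i<n. A i \<inter> ball 0 R) \<in> sets lebesgue" for n by (rule sets_completionI_sets)
      show "incseq (\<lambda>n. \<Union>i<n. A i \<inter> ball 0 R)"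
        by (intro incseq_SucI) (auto simp: less_Suc_eq)
      have "indicator (\<Union>i<n. A i \<inter> ball 0 R) = (\<lambda>x. \<Sum>i<n. indicator (A i \<inter> ball 0 R) x :: complex)" for n
        using union(1) by (intro ext indicator_UN_disjoint) (auto simp: disjoint_family_on_def)
      then show "approximable (indicator (\<Union>i<n. A i \<inter> ball 0 R))" for n
        using union by (simp add: approximable_sum)
      have "emeasure lebesgue ((\<Union>i. A i) \<inter> ball 0 R) \<le> emeasure lebesgue (ball (0::real^2) R)"
        by (intro emeasure_mono) auto
      also have "\<dots> < \<infinity>" using emeasure_lborel_ball_finite by simp
      finally show "emeasure lebesgue (\<Union>n. \<Union>i<n. A i \<inter> ball 0 R) < \<infinity>" unfolding UN .
    qed
    then show ?case unfolding UN .
  qed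
qed

text \<open>A Lebesgue set is a Borel set up to a null set, and the Borel part is exhausted by its
  intersections with growing balls.\<close>

lemma approximable_indicator:
  assumes A: "A \<in> sets lebesgue" and fin: "emeasure lebesgue A < \<infinity>"
  shows "approximable (indicator A)"
proof -
  obtain S N N' where S: "A = S \<union> N" "N \<subseteq> N'" "N' \<in> null_sets lborel" "S \<in> sets lborel"
    using sets_completionE[OF A] by blast
  have UN: "(\<Union>n. S \<inter> ball 0 (real (Suc n))) = S"
  proof (intro equalityI subsetI)
    fix x assume "x \<in> S"
    moreover obtain n where "norm x < real n" using reals_Archimedean2 by blast
    ultimately show "x \<in> (\<Union>n. S \<inter> ball 0 (real (Suc n)))" by (intro UN_I[of n]) auto
  qed auto
  have "approximable (indicator (\<Union>n. S \<inter> ball 0 (real (Suc n))))"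
  proof (rule approximable_indicator_Union)
    have "S \<inter> ball 0 (real (Suc n)) \<in> sets lborel" for n using S(4) by simp
    then show "S \<inter> ball 0 (real (Suc n)) \<in> sets lebesgue" for n by (rule sets_completionI_sets)
    show "incseq (\<lambda>n. S \<inter> ball 0 (real (Suc n)))" by (intro incseq_SucI) auto
    show "approximable (indicator (S \<inter> ball 0 (real (Suc n))))" for n
      using S(4) by (intro approximable_indicator_borel_ball) auto
    have "emeasure lebesgue S \<le> emeasure lebesgue A" using A S by (intro emeasure_mono) auto
    then show "emeasure lebesgue (\<Union>n. S \<inter> ball 0 (real (Suc n))) < \<infinity>" unfolding UN using fin by simp
  qed
  then have "approximable (indicator S)" unfolding UN .
  moreover have "(indicator A :: real^2 \<Rightarrow> complex) \<in> borel_measurable lebesgue"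
    using A by (rule borel_measurable_indicator)
  moreover have "AE x in lebesgue. indicator S x = (indicator A x :: complex)"
  proof -
    have "AE x in lebesgue. x \<notin> N'"
      by (intro AE_not_in null_sets_completionI S(3))
    then show ?thesis by eventually_elim (use S in \<open>auto simp: indicator_def\<close>)
  qed
  ultimately show ?thesis by (rule approximable_cong_AE)
qed

section \<open>From simple functions to all of L2\<close>

text \<open>A Chebyshev estimate: finite \<open>sq_int\<close> forces each level set of a nonzero
  value to have finite measure, so \<open>F\<close> is a finite combination of approximable
  indicators.\<close>

lemma approximable_simple_function:
  assumes F: "simple_function lebesgue F" and fin: "sq_int F < \<infinity>"
  shows "approximable F"
proof -
  have fF: "finite (range F)" using simple_functionD(1)[OF F] by simp
  have meas: "F -` {y} \<in> sets lebesgue" for y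
    using simple_functionD(2)[OF F, of "{y}"] by simp
  have "emeasure lebesgue (F -` {y}) < \<infinity>" if y: "y \<noteq> 0" for y
  proof -
    have "ennreal ((norm y)\<^sup>2) * emeasure lebesgue (F -` {y}) = (\<integral>\<^sup>+x. ennreal ((norm y)\<^sup>2) * indicator (F -` {y}) x \<partial>lebesgue)"
      using meas by (simp add: nn_integral_cmult_indicator)
    also have "\<dots> \<le> sq_int F"
      unfolding sq_int_def by (intro nn_integral_mono) (auto simp: indicator_def)
    finally have "ennreal ((norm y)\<^sup>2) * emeasure lebesgue (F -` {y}) < \<infinity>"
      using fin by (rule le_less_trans)
    then show ?thesis using y by (auto simp: ennreal_mult_less_top)
  qed
  then have "approximable (\<lambda>x. \<Sum>y\<in>range F - {0}. y * indicator (F -` {y}) x)"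
    by (intro approximable_sum approximable_cmult approximable_indicator meas) auto
  moreover have "(\<Sum>y\<in>range F - {0}. y * indicator (F -` {y}) x) = F x" for x
  proof -
    have "(\<Sum>y\<in>range F - {0}. y * indicator (F -` {y}) x) = (\<Sum>y\<in>range F - {0}. if y = F x then F x else 0)"
      by (intro sum.cong) (auto simp: indicator_def)
    also have "\<dots> = F x" using fF by (subst sum.delta) auto
    finally show ?thesis .
  qed
  ultimately show ?thesis by simp
qed

lemma square_integrable_approximable:
  assumes f: "square_integrable f"
  shows "approximable f"
proof -
  have m [measurable]: "f \<in> borel_measurable lebesgue" and fin: "sq_int f < \<infinity>"
    using f by (auto simp: square_integrable_iff)
  obtain F where F: "\<And>i. simple_function lebesgue (F i)" "\<And>x. (\<lambda>i. F i x) \<longlonglongrightarrow> f x" "\<And>i x. norm (F i x) \<le> 2 * norm (f x)"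
    using borel_measurable_implies_sequence_metric[OF m, of 0] by auto
  have mF [measurable]: "F i \<in> borel_measurable lebesgue" for i
    using F(1) by (rule borel_measurable_simple_function)
  have fin': "sq_int (\<lambda>x. of_real c * f x) < \<infinity>" for c
    using fin by (simp add: sq_int_cmult ennreal_mult_less_top)
  have "sq_int (F i) \<le> sq_int (\<lambda>x. of_real 2 * f x)" for i
    unfolding sq_int_def by (intro nn_integral_mono ennreal_leI power_mono) (use F(3) in \<open>auto simp: norm_mult\<close>)
  then have "sq_int (F i) < \<infinity>" for i
    using fin'[of 2] by (rule le_less_trans)
  then have "approximable (F i)" for i
    using F(1) by (intro approximable_simple_function)
  moreover have "(\<lambda>i. sq_int (\<lambda>x. F i x - f x)) \<longlonglongrightarrow> 0"
  \<comment> \<open>The approximating simple functions satisfy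
    \<open>norm (F i x) \<le> 2 * norm (f x)\<close>, so three times \<open>f\<close> dominates the
    difference.\<close>
  proof (rule sq_int_dominated[where w="\<lambda>x. of_real 3 * f x"])
    show "norm (F i x - f x) \<le> norm (of_real 3 * f x)" for i x
      using norm_triangle_ineq4[of "F i x" "f x"] F(3)[of i x] by (simp add: norm_mult)
    show "sq_int (\<lambda>x. of_real 3 * f x) < \<infinity>" by (rule fin')
  qed (use F(2) in auto)
  ultimately show ?thesis by (rule approximable_limit[OF m, of F])
qed

text \<open>Supplies the hypothesis \<open>dense\<close> of the extension lemmas; approximating to
  within \<open>e / 2\<close> yields the strict inequality.\<close>

lemma schwartz_dense:
  assumes "square_integrable f" and e: "e > 0"
  shows "\<exists>u. schwartz u \<and> sq_int (\<lambda>x. u x - f x) < ennreal e"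
proof -
  obtain u where u: "gauss_poly u" "sq_int (\<lambda>x. u x - f x) \<le> ennreal (e / 2)"
    using square_integrable_approximable[OF assms(1)] e unfolding approximable_def by (meson half_gt_zero)
  have "ennreal (e / 2) < ennreal e" using e by (simp add: ennreal_less_iff)
  with u show ?thesis using gauss_poly_schwartz by (blast intro: le_less_trans)
qed

section \<open>The heat semigroup\<close>

lemma nn_integral_exp_atLeast:
  fixes c a :: real
  assumes "c > 0"
  shows "(\<integral>\<^sup>+x. ennreal (exp (- c * x)) * indicator {a..} x \<partial>lborel) = ennreal (exp (- c * a) / c)"
proof -
  have "((\<lambda>x. - exp (- c * x) / c) \<longlongrightarrow> - 0 / c) at_top"
    using assms by (intro tendsto_intros filterlim_compose[OF exp_at_bot])
      (auto simp: filterlim_uminus_at_top[symmetric] intro!: filterlim_tendsto_pos_mult_at_top[OF tendsto_const] filterlim_ident)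
  moreover have "((\<lambda>x. - exp (- c * x) / c) has_real_derivative exp (- c * x)) (at x)" for x
    using assms by (auto intro!: derivative_eq_intros simp: field_simps)
  ultimately show ?thesis
    using nn_integral_FTC_atLeast[of "\<lambda>x. exp (- c * x)" a "\<lambda>x. - exp (- c * x) / c" 0] by simp
qed

text \<open>After the exchange of integrals the range of \<open>\<tau>\<close> is split at 1. The
  part near 0 produces the logarithm and the tail a constant; each is at most
  \<open>pi * ln (exp 1 + 1 / t)\<close>, whence the factor 2.\<close>

lemma nn_integral_heat_weight_le:
  assumes t: "t > 0"
  shows "(\<integral>\<^sup>+\<xi>. ennreal (exp (- (2 * t) * (norm (\<xi> :: real^2))\<^sup>2) / (1 + (norm \<xi>)\<^sup>2)) \<partial>lborel) \<le> ennreal (2 * pi * ln (exp 1 + 1 / t))"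
proof -
  have weight: "ennreal (exp (- (2 * t) * (norm \<xi>)\<^sup>2) / (1 + (norm \<xi>)\<^sup>2)) =
      (\<integral>\<^sup>+\<tau>. ennreal (exp (- \<tau>) * exp (- (2 * t + \<tau>) * (norm \<xi>)\<^sup>2)) * indicator {0..} \<tau> \<partial>lborel)" for \<xi> :: "real^2"
  proof -
    let ?s = "(norm \<xi>)\<^sup>2"
    have "exp (- \<tau>) * exp (- (2 * t + \<tau>) * ?s) = exp (- (2 * t) * ?s) * exp (- (1 + ?s) * \<tau>)" for \<tau>
      by (simp add: exp_add[symmetric] algebra_simps)
    then have "(\<integral>\<^sup>+\<tau>. ennreal (exp (- \<tau>) * exp (- (2 * t + \<tau>) * ?s)) * indicator {0..} \<tau> \<partial>lborel) =
       (\<integral>\<^sup>+\<tau>. ennreal (exp (- (2 * t) * ?s)) * (ennreal (exp (- (1 + ?s) * \<tau>)) * indicator {0..} \<tau>) \<partial>lborel)"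
      by (simp only: ennreal_mult exp_ge_zero mult.assoc)
    also have "\<dots> = ennreal (exp (- (2 * t) * ?s)) * ennreal (1 / (1 + ?s))"
      by (subst nn_integral_cmult, simp) (subst nn_integral_exp_atLeast, simp_all add: add_pos_nonneg)
    finally show ?thesis by (simp add: ennreal_mult[symmetric])
  qed
  have inner: "(\<integral>\<^sup>+\<xi>. ennreal (exp (- \<tau>) * exp (- (2 * t + \<tau>) * (norm (\<xi> :: real^2))\<^sup>2)) * indicator {0..} \<tau> \<partial>lborel)
      = ennreal (exp (- \<tau>) * (pi / (2 * t + \<tau>))) * indicator {0..} \<tau>" for \<tau>
  proof (cases "\<tau> \<ge> 0")
    case True
    then have pos: "2 * t + \<tau> > 0" using t by simp
    have "has_bochner_integral lborel (\<lambda>\<xi>::real^2. exp (- (2 * t + \<tau>) * (norm \<xi>)\<^sup>2)) (pi / (2 * t + \<tau>))"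
      using gauss_integral[OF pos, of "0 :: real^2"] pos by (simp add: real_sqrt_pow2)
    from has_bochner_integral_mult_right[OF this, of "exp (- \<tau>)"]
    have "(\<integral>\<^sup>+\<xi>. ennreal (exp (- \<tau>) * exp (- (2 * t + \<tau>) * (norm (\<xi> :: real^2))\<^sup>2)) \<partial>lborel)
        = ennreal (exp (- \<tau>) * (pi / (2 * t + \<tau>)))"
      by (subst nn_integral_eq_integral) (auto simp: has_bochner_integral_iff)
    moreover have "indicator {0..} \<tau> = (1 :: ennreal)" using True by simp
    ultimately show ?thesis by (simp only: mult_1_right)
  qed simp
  have "(\<integral>\<^sup>+\<xi>. ennreal (exp (- (2 * t) * (norm (\<xi> :: real^2))\<^sup>2) / (1 + (norm \<xi>)\<^sup>2)) \<partial>lborel) =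
     (\<integral>\<^sup>+\<tau>. \<integral>\<^sup>+\<xi>. ennreal (exp (- \<tau>) * exp (- (2 * t + \<tau>) * (norm (\<xi> :: real^2))\<^sup>2)) * indicator {0..} \<tau> \<partial>lborel \<partial>lborel)"
    unfolding weight by (rule lborel_pair.Fubini') measurable
  also have "\<dots> = (\<integral>\<^sup>+\<tau>. ennreal (exp (- \<tau>) * (pi / (2 * t + \<tau>))) * indicator {0..} \<tau> \<partial>lborel)"
    unfolding inner ..
  \<comment> \<open>Up to 1 the exponential is bounded by 1; beyond 1 the fraction is bounded by
    \<open>pi\<close>. The overlap at the single point 1 only enlarges the right side.\<close>
  also have "\<dots> \<le> (\<integral>\<^sup>+\<tau>. ennreal (pi / (2 * t + \<tau>)) * indicator {0..1} \<tau> + ennreal pi * (ennreal (exp (- 1 * \<tau>)) * indicator {1..} \<tau>) \<partial>lborel)"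
  proof (intro nn_integral_mono)
    fix \<tau> :: real
    consider "\<tau> < 0" | "0 \<le> \<tau>" "\<tau> \<le> 1" | "\<tau> > 1" by linarith
    then show "ennreal (exp (- \<tau>) * (pi / (2 * t + \<tau>))) * indicator {0..} \<tau> \<le>
      ennreal (pi / (2 * t + \<tau>)) * indicator {0..1} \<tau> + ennreal pi * (ennreal (exp (- 1 * \<tau>)) * indicator {1..} \<tau>)"
    proof cases
      case 2
      have "exp (- \<tau>) * (pi / (2 * t + \<tau>)) \<le> 1 * (pi / (2 * t + \<tau>))"
        using 2 t by (intro mult_right_mono) auto
      then show ?thesis using 2 by (intro add_increasing2) (auto intro!: ennreal_leI)
    next
      case 3
      have "exp (- \<tau>) * (pi / (2 * t + \<tau>)) \<le> exp (- \<tau>) * (pi / 1)"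
        using 3 t by (intro mult_left_mono divide_left_mono) auto
      then show ?thesis using 3 by (simp add: ennreal_mult[symmetric] mult.commute)
    qed simp
  qed
  also have "\<dots> = (\<integral>\<^sup>+\<tau>. ennreal (pi / (2 * t + \<tau>)) * indicator {0..1} \<tau> \<partial>lborel) + ennreal pi * (\<integral>\<^sup>+\<tau>. ennreal (exp (- 1 * \<tau>)) * indicator {1..} \<tau> \<partial>lborel)"
    by (subst nn_integral_add) (auto simp: nn_integral_cmult)
  also have "(\<integral>\<^sup>+\<tau>. ennreal (pi / (2 * t + \<tau>)) * indicator {0..1} \<tau> \<partial>lborel) = ennreal (pi * ln (2 * t + 1) - pi * ln (2 * t + 0))"
    using t by (intro nn_integral_FTC_Icc) (auto intro!: derivative_eq_intros)
  also have "(\<integral>\<^sup>+\<tau>. ennreal (exp (- 1 * \<tau>)) * indicator {1..} \<tau> \<partial>lborel) = ennreal (exp (- 1))"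
    using nn_integral_exp_atLeast[of 1 1] by simp
  also have "ennreal (pi * ln (2 * t + 1) - pi * ln (2 * t + 0)) + ennreal pi * ennreal (exp (- 1)) \<le> ennreal (2 * pi * ln (exp 1 + 1 / t))"
  proof -
    have "ln (2 * t + 1) - ln (2 * t + 0) = ln (1 + 1 / (2 * t))"
      using t by (subst ln_divide_pos[symmetric]) (auto simp: add_divide_distrib)
    also have "\<dots> \<le> ln (exp 1 + 1 / t)"
    proof -
      have "1 / (2 * t) \<le> 1 / t" using t by (simp add: field_simps)
      moreover have "1 \<le> exp (1::real)" by simp
      ultimately have "1 + 1 / (2 * t) \<le> exp 1 + 1 / t" by linarith
      then show ?thesis using t by (intro ln_mono) (auto intro: add_pos_pos)
    qed
    finally have 1: "pi * (ln (2 * t + 1) - ln (2 * t + 0)) \<le> pi * ln (exp 1 + 1 / t)"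
      by (intro mult_left_mono) auto
    have "exp (-1) \<le> (1::real)" by simp
    \<comment> \<open>The summand \<open>exp 1\<close> inside the logarithm keeps it at least 1 for
      large \<open>t\<close>, so it also absorbs the constant tail.\<close>
    also have "1 \<le> ln (exp 1 + 1 / t)"
      using t by (subst ln_ge_iff) (auto intro: add_pos_pos)
    finally have 2: "pi * exp (-1) \<le> pi * ln (exp 1 + 1 / t)"
      by (intro mult_left_mono) auto
    \<comment> \<open>Nonnegativity of this difference permits splitting \<open>ennreal\<close> over
      the sum.\<close>
    have "ln (2 * t + 0) \<le> ln (2 * t + 1)" using t by simp
    then have 3: "0 \<le> pi * (ln (2 * t + 1) - ln (2 * t + 0))" by (intro mult_nonneg_nonneg) auto
    from 1 2 have "pi * (ln (2 * t + 1) - ln (2 * t + 0)) + pi * exp (- 1) \<le> 2 * pi * ln (exp 1 + 1 / t)" by linarith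
    then have "ennreal (pi * (ln (2 * t + 1) - ln (2 * t + 0)) + pi * exp (- 1)) \<le> ennreal (2 * pi * ln (exp 1 + 1 / t))"
      by (rule ennreal_leI)
    moreover have "ennreal (pi * (ln (2 * t + 1) - ln (2 * t + 0)) + pi * exp (- 1))
        = ennreal (pi * (ln (2 * t + 1) - ln (2 * t + 0))) + ennreal pi * ennreal (exp (- 1))"
      using 3 by (subst ennreal_plus) (simp_all add: ennreal_mult)
    ultimately show ?thesis by (simp only: right_diff_distrib)
  qed
  finally show ?thesis .
qed

section \<open>From the Fourier side to the supremum norm\<close>

lemma fourier_square_integrable: "square_integrable f \<Longrightarrow> square_integrable (fourier f)"
  unfolding fourier_def fourier_schwartz_eq
  by (rule L2_extension_fourier_L1_spec(1)[OF schwartz_dense]) auto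

text \<open>Takes the root in the Cauchy-Schwarz estimate before finiteness of the left side is
  known: an infinite \<open>x\<close> would have an infinite square.\<close>

lemma ennreal_power2_le_imp_le:
  assumes "x\<^sup>2 \<le> (ennreal r)\<^sup>2" "r \<ge> 0"
  shows "x \<le> ennreal r"
proof (cases x)
  case (real y)
  then have "ennreal (y\<^sup>2) \<le> ennreal (r\<^sup>2)" using assms by (simp add: ennreal_power)
  then have "y\<^sup>2 \<le> r\<^sup>2" by (simp add: ennreal_le_iff)
  then show ?thesis using real assms(2) by (auto intro!: ennreal_leI power2_le_imp_le)
next
  case top
  then show ?thesis using assms by (simp add: ennreal_power power2_eq_square top_unique ennreal_mult_eq_top_iff)
qed

text \<open>The first two conclusions are what \<open>L2_extension_fourier_L1_eq\<close> requires of
  \<open>G\<close>; the third is the Cauchy-Schwarz estimate against the Sobolev weight.\<close>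

lemma heat_multiplier_bound:
  assumes f: "f \<in> H1" and t: "t > 0"
  defines "G \<equiv> \<lambda>\<xi>. of_real (exp (- t * (norm \<xi>)\<^sup>2)) * fourier f \<xi>"
  shows "square_integrable G" and "integrable lebesgue G"
    and "(LINT \<xi>|lebesgue. norm (G \<xi>)) \<le> sqrt (2 * pi * ln (exp 1 + 1 / t)) * H1_norm f"
proof -
  have sq: "square_integrable (fourier f)" using f by (auto simp: H1_def intro: fourier_square_integrable)
  then have F [measurable]: "fourier f \<in> borel_measurable lebesgue" by (simp add: square_integrable_iff)
  have [measurable]: "(\<lambda>\<xi>::real^2. norm \<xi>) \<in> borel_measurable lebesgue"
    by (intro measurable_completion) simp
  have G [measurable]: "G \<in> borel_measurable lebesgue" unfolding G_def by measurable
  have "sq_int G \<le> sq_int (fourier f)"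
    unfolding sq_int_def
  proof (intro nn_integral_mono ennreal_leI power_mono)
    fix \<xi>
    have "exp (- t * (norm \<xi>)\<^sup>2) * norm (fourier f \<xi>) \<le> 1 * norm (fourier f \<xi>)"
      using t by (intro mult_right_mono) auto
    then show "norm (G \<xi>) \<le> norm (fourier f \<xi>)" by (simp add: G_def norm_mult)
  qed simp
  then show "square_integrable G" using sq G by (auto simp: square_integrable_iff intro: le_less_trans)
  let ?L = "ln (exp 1 + 1 / t)"
  define N where "N = (LINT \<xi>|lebesgue. (1 + (norm \<xi>)\<^sup>2) * (norm (fourier f \<xi>))\<^sup>2)"
  have N0: "N \<ge> 0" unfolding N_def by (intro integral_nonneg_AE) auto
  have L0: "?L \<ge> 0" using t by (intro ln_ge_zero) (auto intro: add_increasing2)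
  have N: "(\<integral>\<^sup>+\<xi>. ennreal ((1 + (norm \<xi>)\<^sup>2) * (norm (fourier f \<xi>))\<^sup>2) \<partial>lebesgue) = ennreal N"
    using f unfolding N_def H1_def by (intro nn_integral_eq_integral) auto
  \<comment> \<open>The Sobolev weight is divided out of the heat factor and attached to the
    transform, so that the square of \<open>?b\<close> integrates to the squared Sobolev
    norm.\<close>
  let ?a = "\<lambda>\<xi>::real^2. exp (- t * (norm \<xi>)\<^sup>2) / sqrt (1 + (norm \<xi>)\<^sup>2)"
  let ?b = "\<lambda>\<xi>::real^2. sqrt (1 + (norm \<xi>)\<^sup>2) * norm (fourier f \<xi>)"
  have pos: "1 + (norm \<xi>)\<^sup>2 > 0" for \<xi> :: "real^2" by (simp add: add_pos_nonneg)
  have "norm (G \<xi>) = ?a \<xi> * ?b \<xi>" for \<xi>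
    using pos[of \<xi>] by (simp add: G_def norm_mult)
  then have "(\<integral>\<^sup>+\<xi>. ennreal (norm (G \<xi>)) \<partial>lebesgue)\<^sup>2 = (\<integral>\<^sup>+\<xi>. ennreal (?a \<xi>) * ennreal (?b \<xi>) \<partial>lebesgue)\<^sup>2"
    using pos by (simp add: ennreal_mult[symmetric] less_imp_le)
  also have "\<dots> \<le> (\<integral>\<^sup>+\<xi>. (ennreal (?a \<xi>))\<^sup>2 \<partial>lebesgue) * (\<integral>\<^sup>+\<xi>. (ennreal (?b \<xi>))\<^sup>2 \<partial>lebesgue)"
    by (rule Cauchy_Schwarz_nn_integral) measurable
  also have "(\<integral>\<^sup>+\<xi>. (ennreal (?b \<xi>))\<^sup>2 \<partial>lebesgue) = ennreal N"
    using pos unfolding N[symmetric] by (simp add: ennreal_power power_mult_distrib less_imp_le)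
  also have "(\<integral>\<^sup>+\<xi>. (ennreal (?a \<xi>))\<^sup>2 \<partial>lebesgue) = (\<integral>\<^sup>+\<xi>. ennreal (exp (- (2 * t) * (norm (\<xi> :: real^2))\<^sup>2) / (1 + (norm \<xi>)\<^sup>2)) \<partial>lborel)"
    unfolding nn_integral_completion
    using pos by (intro nn_integral_cong) (simp add: ennreal_power power_divide less_imp_le exp_of_nat_mult[symmetric] exp_double[symmetric] mult.assoc)
  also have "\<dots> * ennreal N \<le> ennreal (2 * pi * ?L) * ennreal N"
    by (intro mult_right_mono nn_integral_heat_weight_le t) simp
  also have "\<dots> = (ennreal (sqrt (2 * pi * ?L) * sqrt N))\<^sup>2"
    using L0 N0 by (simp add: ennreal_power power_mult_distrib ennreal_mult[symmetric])
  finally have "(\<integral>\<^sup>+\<xi>. ennreal (norm (G \<xi>)) \<partial>lebesgue)\<^sup>2 \<le> (ennreal (sqrt (2 * pi * ?L) * sqrt N))\<^sup>2" .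
  then have le: "(\<integral>\<^sup>+\<xi>. ennreal (norm (G \<xi>)) \<partial>lebesgue) \<le> ennreal (sqrt (2 * pi * ?L) * sqrt N)"
    by (rule ennreal_power2_le_imp_le) (use L0 N0 in simp)
  \<comment> \<open>The finite bound on the integral of the modulus is itself the proof of
    integrability.\<close>
  then show int: "integrable lebesgue G"
    by (intro integrableI_bounded G) (auto intro: le_less_trans)
  have "ennreal (LINT \<xi>|lebesgue. norm (G \<xi>)) \<le> ennreal (sqrt (2 * pi * ?L) * sqrt N)"
    using le int by (subst nn_integral_eq_integral[symmetric]) auto
  then have "(LINT \<xi>|lebesgue. norm (G \<xi>)) \<le> sqrt (2 * pi * ?L) * sqrt N"
    using L0 N0 by (subst (asm) ennreal_le_iff) auto
  then show "(LINT \<xi>|lebesgue. norm (G \<xi>)) \<le> sqrt (2 * pi * ?L) * H1_norm f"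
    by (simp add: H1_norm_def N_def)
qed

lemma norm_fourier_L1_le:
  assumes u: "integrable lebesgue u"
  shows "norm (fourier_L1 s u \<xi>) \<le> 1 / (2 * pi) * (LINT x|lebesgue. norm (u x))"
proof -
  have "norm (LINT x|lebesgue. exp (\<i> * of_real (s * (x \<bullet> \<xi>))) * u x) \<le> (LINT x|lebesgue. norm (exp (\<i> * of_real (s * (x \<bullet> \<xi>))) * u x))"
    by (rule integral_norm_bound)
  also have "\<dots> = (LINT x|lebesgue. norm (u x))"
    by (simp only: norm_mult norm_exp_i_times mult_1)
  finally show ?thesis
    by (simp only: fourier_L1_def norm_mult) (simp add: norm_divide divide_right_mono)
qed

text \<open>For this multiplier the abstract extension agrees almost everywhere with an absolutely
  convergent integral, which is bounded by the L1 norm of \<open>G\<close>; an essential supremum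
  does not see the exceptional null set.\<close>

lemma Linf_norm_heat_le:
  assumes f: "f \<in> H1" and t: "t > 0"
  shows "Linf_norm (heat_semigroup t f) \<le> ereal (1 / (2 * pi) * (sqrt (2 * pi * ln (exp 1 + 1 / t)) * H1_norm f))"
proof -
  define G where "G \<xi> = of_real (exp (- t * (norm \<xi>)\<^sup>2)) * fourier f \<xi>" for \<xi>
  note G = heat_multiplier_bound[OF f t, folded G_def]
  have heat: "heat_semigroup t f = L2_extension (fourier_L1 1) G"
    by (simp add: heat_semigroup_def inv_fourier_def inv_fourier_schwartz_eq G_def[abs_def])
  \<comment> \<open>Measurability of the representative picked by Hilbert choice is required for the
    bound on \<open>esssup\<close>.\<close>
  have "heat_semigroup t f \<in> borel_measurable lebesgue"
    using L2_extension_fourier_L1_spec(1)[OF schwartz_dense G(1), of 1] by (simp add: heat square_integrable_iff)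
  then have [measurable]: "(\<lambda>x. ereal (norm (heat_semigroup t f x))) \<in> borel_measurable lebesgue" by simp
  have "AE x in lebesgue. heat_semigroup t f x = fourier_L1 1 G x"
    unfolding heat by (rule L2_extension_fourier_L1_eq[OF schwartz_dense G(1,2)]) auto
  then have "AE x in lebesgue. ereal (norm (heat_semigroup t f x)) \<le> ereal (1 / (2 * pi) * (sqrt (2 * pi * ln (exp 1 + 1 / t)) * H1_norm f))"
  proof eventually_elim
    case (elim x)
    have "norm (fourier_L1 1 G x) \<le> 1 / (2 * pi) * (LINT \<xi>|lebesgue. norm (G \<xi>))"
      by (rule norm_fourier_L1_le[OF G(2)])
    also have "\<dots> \<le> 1 / (2 * pi) * (sqrt (2 * pi * ln (exp 1 + 1 / t)) * H1_norm f)"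
      by (intro mult_left_mono G(3)) simp
    finally show ?case by (simp add: elim)
  qed
  then show ?thesis unfolding Linf_norm_def by (intro esssup_I) auto
qed

text \<open>In the extended reals \<open>0 / 0 = 0\<close>, so a vanishing denominator needs no separate hypothesis.\<close>

lemma ereal_divide_le_of_le_mult:
  fixes x :: ereal and c d :: real
  assumes "x \<le> ereal (c * d)" "0 \<le> c" "0 \<le> d"
  shows "x / ereal d \<le> ereal c"
  using assms by (cases x; cases "d = 0") (auto simp: divide_ereal_def field_simps zero_ereal_def)

theorem theorem1p1:
  shows "\<exists>C::real. C > 0 \<and>
    (SUP t \<in> {0::real<..}. heat_H1_Linf_norm t / ereal (ln (exp 1 + 1 / t) powr (1 / 2))) \<le> ereal C"
\<comment> \<open>The constant combines the normalization \<open>1 / (2 * pi)\<close> of the inverse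
  transform with the factor \<open>sqrt (2 * pi)\<close> of the weight integral.\<close>
proof (intro exI[of _ "sqrt (2 * pi) / (2 * pi)"] conjI SUP_least)
  show "sqrt (2 * pi) / (2 * pi) > 0" by simp
  fix t :: real assume "t \<in> {0<..}"
  then have t: "t > 0" by simp
  let ?L = "ln (exp 1 + 1 / t)"
  have L: "?L \<ge> 0" using t by (intro ln_ge_zero) (auto intro: add_increasing2)
  have "heat_H1_Linf_norm t \<le> ereal (sqrt (2 * pi) / (2 * pi) * sqrt ?L)"
    unfolding heat_H1_Linf_norm_def
  proof (intro SUP_least ereal_divide_le_of_le_mult)
    fix f assume "f \<in> {f \<in> H1. \<not> (AE x in lebesgue. f x = 0)}"
    then have "f \<in> H1" by simp
    from Linf_norm_heat_le[OF this t]
    show "Linf_norm (heat_semigroup t f) \<le> ereal (sqrt (2 * pi) / (2 * pi) * sqrt ?L * H1_norm f)"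
      by (simp add: real_sqrt_mult)
    show "0 \<le> H1_norm f" unfolding H1_norm_def by (intro real_sqrt_ge_zero integral_nonneg_AE) auto
  qed (use L in auto)
  \<comment> \<open>For a nonnegative base the power 1/2 is the square root, which matches the bound
    just obtained.\<close>
  then show "heat_H1_Linf_norm t / ereal (?L powr (1 / 2)) \<le> ereal (sqrt (2 * pi) / (2 * pi))"
    using L by (intro ereal_divide_le_of_le_mult) (auto simp: powr_half_sqrt)
qed

end
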